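(* Let $T>0$ and $p>1$. Let $a\colon\mathbb{R}\to\mathbb{R}$ be a $T$-periodic sign-changing continuous function, having a finite number of zeros in $[0,T[$ and satisfying the mean value condition $$\int_0^T a(t)\,\mathrm{d}t<0.$$ Then there exists a positive $T$-periodic solution of the differential equation $$\left(\frac{u'}{\sqrt{1-(u')^{2}}}\right)'+a(t)\bigl(e^{u^{p}}-1\bigr)=0.$$
   Context: Sign-changing means that $a$ takes both positive and negative values. A $T$-periodic solution is a continuously differentiable $T$-periodic function $u\colon\mathbb{R}\to\mathbb{R}$ such that $|u'(t)|<1$ for every $t$, the map $t\mapsto u'(t)/\sqrt{1-(u'(t))^2}$ is absolutely continuous on $[0,T]$, and the differential equation is satisfied for a.e. $t$. It is positive if $u(t)>0$ for every $t$. *)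

theory Defs
  imports "HOL-Analysis.Analysis" "HOL-Library.Periodic_Fun"
begin

text \<open>
  Absolute continuity of a function (the library's \<^const>\<open>absolutely_continuous\<close> is about
  measures). The finite families of non-overlapping compact subintervals of \<open>S\<close> are the divisions
  contained in \<open>S\<close>; a member \<open>K\<close> is the interval with endpoints \<open>Inf K\<close> and \<open>Sup K\<close>.
\<close>
definition absolutely_continuous_on :: "real set \<Rightarrow> (real \<Rightarrow> real) \<Rightarrow> bool" where
  "absolutely_continuous_on S f \<longleftrightarrow>
     (\<forall>\<epsilon>>0. \<exists>\<delta>>0. \<forall>\<D>. \<D> division_of \<Union>\<D> \<and> \<Union>\<D> \<subseteq> S \<and> (\<Sum>K\<in>\<D>. Sup K - Inf K) < \<delta> \<longrightarrow>
        (\<Sum>K\<in>\<D>. \<bar>f (Sup K) - f (Inf K)\<bar>) < \<epsilon>)"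

definition sign_changing :: "(real \<Rightarrow> real) \<Rightarrow> bool" where
  "sign_changing a \<longleftrightarrow> (\<exists>t. a t > 0) \<and> (\<exists>t. a t < 0)"

text \<open>
  \<open>u\<close> is a \<open>T\<close>-periodic solution of \<open>(u' / sqrt (1 - u'\<^sup>2))' + a(t) g(u) = 0\<close>.
\<close>
definition periodic_solution ::
    "real \<Rightarrow> (real \<Rightarrow> real) \<Rightarrow> (real \<Rightarrow> real) \<Rightarrow> (real \<Rightarrow> real) \<Rightarrow> bool" where
  "periodic_solution T a g u \<longleftrightarrow>
     u C1_differentiable_on UNIV \<and>
     periodic_fun_simple u T \<and>
     (\<forall>t. \<bar>deriv u t\<bar> < 1) \<and>
     (let \<Phi> = (\<lambda>t. deriv u t / sqrt (1 - (deriv u t)\<^sup>2)) in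
       absolutely_continuous_on {0..T} \<Phi> \<and>
       (AE t in lebesgue. \<Phi> differentiable at t \<and> deriv \<Phi> t + a t * g (u t) = 0))"

end

theory Submission
  imports Defs
begin

text \<open>
  Put \<open>\<phi> v = v / sqrt (1 - v\<^sup>2)\<close>. With the momentum \<open>y = \<phi> u'\<close> the equation becomes the planar system
  \<open>u' = velocity y\<close>, \<open>y' = - a g(u)\<close>, where \<open>velocity\<close>, the inverse of \<open>\<phi>\<close>, takes values in
  \<open>]-1, 1[\<close>, and where \<open>g\<close> is continued by \<open>0\<close> to the negative half-line. All solutions are global,
  and a \<open>T\<close>-periodic one is a zero of the map that sends the initial point \<open>(x, z)\<close> to the pair
  \<open>F\<^sub>1 = u T - x\<close>, \<open>F\<^sub>2 = y T - z\<close>. Constants \<open>u \<le> 0\<close> are trivial zeros, and the task is to find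
  another one. A nontrivial periodic solution is automatically positive: at a nonpositive minimum it
  would coincide with a constant solution (\<open>rest_persists\<close>).

  The zero is found by a version of the Poincare-Miranda theorem in which the sign of \<open>F\<^sub>2\<close> is
  prescribed only where \<open>F\<^sub>1 = 0\<close> (\<open>rectangle_zero\<close>); it follows from Brouwer's theorem. Three facts
  about orbits that satisfy \<open>u T = u 0\<close> make it applicable.

  Near the origin, superlinearity of \<open>g\<close> keeps the oscillation of \<open>u\<close> negligible against its
  maximum \<open>\<mu>\<close>. Hence \<open>y T - y 0\<close>, which is minus the integral of \<open>a g(u)\<close>, is close to \<open>- g(\<mu>)\<close>
  times the integral of \<open>a\<close>, and that integral is negative: the orbit does not lose momentum
  (\<open>gain_near_origin\<close>).

  Far from the origin, time is shifted so that \<open>a 0 > 0\<close>. Since \<open>g(x + h) / g(x)\<close> tends to infinity,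
  what happens at the larger values of \<open>u\<close> dominates everything else. In particular, if \<open>u\<close> is
  large and stops growing just before a stretch where \<open>a \<ge> 0\<close>, the momentum there becomes so negative
  that \<open>u\<close> never recovers within the period (\<open>large_orbit_keeps_falling\<close>). So a large orbit with
  \<open>u T = u 0\<close> has to start upwards, and its first maximum lies at the end of a stretch where
  \<open>a \<ge> 0\<close>. To spend all its momentum there it must have brought along much more than
  it can regain later at heights below \<open>u 0\<close>; hence \<open>y T < y 0\<close>
  (\<open>large_closed_orbit_loses_momentum\<close>).

  Finally, on the left edge \<open>x = - T\<close> of the rectangle the orbit stays in \<open>u \<le> 0\<close>, so \<open>F\<^sub>2 = 0\<close>.

  To rule out the trivial zeros, a weight that is positive exactly for small \<open>\<bar>z\<bar>\<close> and
  \<open>x\<close> below a small bound is added to \<open>F\<^sub>2\<close>. By the first fact \<open>F\<^sub>2 \<ge> 0\<close> wherever the weight is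
  positive and \<open>F\<^sub>1 = 0\<close>, so this creates no new zeros and destroys the trivial ones. On the
  right edge \<open>F\<^sub>2 < 0\<close> by the second fact, on the horizontal edges the momentum is too large to change
  sign, and a nontrivial zero results (\<open>nontrivial_closed_orbit\<close>).
\<close>

section \<open>A Lipschitz flow on a compact time interval\<close>

text \<open>
  Picard iteration in the sup norm contracts only on short intervals. Working with the unknown
  \<open>exp (- 2 K t) X t\<close> turns the Picard operator into a contraction with factor \<open>1/2\<close> on the whole of
  \<open>[0, T]\<close>. As the initial value enters that operator additively, the fixed point depends on it in a
  Lipschitz way.
\<close>
lemma lipschitz_flow:
  fixes f :: "real \<Rightarrow> 'b::banach \<Rightarrow> 'b"
  assumes T: "0 \<le> T"
    and cont: "continuous_on ({0..T} \<times> UNIV) (\<lambda>(t, x). f t x)"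
    and lip: "\<And>t x y. t \<in> {0..T} \<Longrightarrow> norm (f t x - f t y) \<le> L * norm (x - y)"
  obtains X where
    "\<And>x. X x 0 = x"
    "\<And>x t. t \<in> {0..T} \<Longrightarrow> (X x has_vector_derivative f t (X x t)) (at t within {0..T})"
    "continuous_on UNIV (\<lambda>x. X x T)"
proof -
  define K where "K = \<bar>L\<bar> + 1"
  have K: "K > 0" by (simp add: K_def)
  have lipK: "norm (f t x - f t y) \<le> K * norm (x - y)" if "t \<in> {0..T}" for t x y
    by (rule order_trans[OF lip[OF that]]) (auto simp: K_def intro!: mult_right_mono)
  have cont_comp: "continuous_on {0..T} (\<lambda>s. f s (v s))" if "continuous_on {0..T} v" for v
  proof -
    have "continuous_on {0..T} (\<lambda>s. (\<lambda>(t, x). f t x) (s, v s))"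
      by (rule continuous_on_compose2[OF cont]) (auto intro!: continuous_intros that)
    then show ?thesis by simp
  qed
  define P where "P x V t = exp (-2 * K * t) *\<^sub>R
      (x + integral {0..t} (\<lambda>s. f s (exp (2 * K * s) *\<^sub>R apply_bcontfun V s)))"
    for x :: 'b and V :: "real \<Rightarrow>\<^sub>C 'b" and t
  have contV: "continuous_on {0..T} (\<lambda>s. f s (exp (2 * K * s) *\<^sub>R apply_bcontfun V s))"
    for V :: "real \<Rightarrow>\<^sub>C 'b"
    by (rule cont_comp) (auto intro!: continuous_intros)
  have intV: "(\<lambda>s. f s (exp (2 * K * s) *\<^sub>R apply_bcontfun V s)) integrable_on {0..t}"
    if "t \<in> {0..T}" for V :: "real \<Rightarrow>\<^sub>C 'b" and t
    by (rule integrable_continuous_real) (use that in \<open>auto intro: continuous_on_subset[OF contV]\<close>)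
  have contP: "continuous_on (cbox 0 T) (P x V)" for x V
    unfolding P_def box_real
    by (intro continuous_intros indefinite_integral_continuous_1 intV) (use T in auto)
  have "\<exists>W. \<forall>t. apply_bcontfun W t = P x V (clamp 0 T t)" for x V
    using continuous_on_cbox_bcontfunE[OF contP[of x V]] by metis
  then obtain Psi where Psi: "\<And>x V t. apply_bcontfun (Psi x V) t = P x V (clamp 0 T t)"
    by metis
  have cl: "clamp 0 T t \<in> {0..T}" for t
    using clamp_in_interval[of "0::real" T t] T by auto
  \<comment> \<open>The weight makes the Lipschitz estimate integrate to \<open>(exp (2 K t) - 1) / 2\<close>, less than half of what the
      prefactor \<open>exp (- 2 K t)\<close> takes away.\<close>
  have contr: "dist (Psi x V) (Psi x W) \<le> 1/2 * dist V W" for x V W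
  proof (rule dist_bound)
    fix t0
    define t where "t = clamp 0 T t0"
    have t: "t \<in> {0..T}" using cl t_def by auto
    let ?d = "dist V W"
    have h: "((\<lambda>s. K * exp (2 * K * s) * ?d) has_integral
        (exp (2 * K * t) / 2 * ?d - exp (2*K*0) / 2 * ?d)) {0..t}"
      by (rule fundamental_theorem_of_calculus)
        (use t K in \<open>auto intro!: derivative_eq_intros simp flip: has_real_derivative_iff_has_vector_derivative\<close>)
    have "norm (integral {0..t} (\<lambda>s. f s (exp (2 * K * s) *\<^sub>R apply_bcontfun V s))
            - integral {0..t} (\<lambda>s. f s (exp (2 * K * s) *\<^sub>R apply_bcontfun W s)))
        = norm (integral {0..t} (\<lambda>s. f s (exp (2 * K * s) *\<^sub>R apply_bcontfun V s)
            - f s (exp (2 * K * s) *\<^sub>R apply_bcontfun W s)))"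
      by (subst integral_diff) (use intV t in auto)
    also have "\<dots> \<le> integral {0..t} (\<lambda>s. K * exp (2 * K * s) * ?d)"
    proof (rule integral_norm_bound_integral)
      show "norm (f s (exp (2 * K * s) *\<^sub>R apply_bcontfun V s) - f s (exp (2 * K * s) *\<^sub>R apply_bcontfun W s))
          \<le> K * exp (2 * K * s) * ?d" if "s \<in> {0..t}" for s
      proof -
        have "norm (f s (exp (2 * K * s) *\<^sub>R apply_bcontfun V s) - f s (exp (2 * K * s) *\<^sub>R apply_bcontfun W s))
          \<le> K * norm (exp (2 * K * s) *\<^sub>R apply_bcontfun V s - exp (2 * K * s) *\<^sub>R apply_bcontfun W s)"
          by (rule lipK) (use that t in auto)
        also have "\<dots> = K * (exp (2 * K * s) * dist (apply_bcontfun V s) (apply_bcontfun W s))"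
          by (simp add: dist_norm flip: scaleR_diff_right)
        also have "\<dots> \<le> K * (exp (2 * K * s) * ?d)"
          by (intro mult_left_mono dist_bounded) (use K in auto)
        finally show ?thesis by (simp add: mult.assoc)
      qed
    qed (use intV t h in \<open>auto intro!: integrable_diff\<close>)
    also have "\<dots> \<le> exp (2 * K * t) / 2 * ?d"
      unfolding integral_unique[OF h] by simp
    finally have "norm (integral {0..t} (\<lambda>s. f s (exp (2 * K * s) *\<^sub>R apply_bcontfun V s))
            - integral {0..t} (\<lambda>s. f s (exp (2 * K * s) *\<^sub>R apply_bcontfun W s))) \<le> exp (2 * K * t) / 2 * ?d" .
    then have "exp (-2 * K * t) * norm (integral {0..t} (\<lambda>s. f s (exp (2 * K * s) *\<^sub>R apply_bcontfun V s))
            - integral {0..t} (\<lambda>s. f s (exp (2 * K * s) *\<^sub>R apply_bcontfun W s)))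
        \<le> exp (-2 * K * t) * (exp (2 * K * t) / 2 * ?d)"
      by (rule mult_left_mono) auto
    also have "\<dots> = ?d / 2" by (simp add: exp_minus field_simps)
    finally show "dist (apply_bcontfun (Psi x V) t0) (apply_bcontfun (Psi x W) t0) \<le> 1/2 * ?d"
      by (simp add: Psi P_def dist_norm flip: t_def scaleR_diff_right)
  qed
  have "\<exists>!V. Psi x V = V" for x
    by (rule banach_fix_type[of "1/2"]) (use contr in auto)
  then obtain V where V: "\<And>x. Psi x (V x) = V x" by metis
  define X where "X x t = exp (2 * K * t) *\<^sub>R apply_bcontfun (V x) t" for x t
  have Xeq: "X x t = x + integral {0..t} (\<lambda>s. f s (X x s))" if "t \<in> {0..T}" for x t
  proof -
    have "clamp 0 T t = t" using that by (simp add: clamp_cancel_cbox)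
    then have "apply_bcontfun (V x) t = P x (V x) t"
      using Psi[of x "V x" t] V by simp
    then have "X x t = exp (2 * K * t) *\<^sub>R P x (V x) t"
      unfolding X_def by simp
    then show ?thesis unfolding P_def X_def by (simp add: exp_minus)
  qed
  show thesis
  proof
    show "X x 0 = x" for x using Xeq[of 0 x] T by simp
    show "(X x has_vector_derivative f t (X x t)) (at t within {0..T})" if t: "t \<in> {0..T}" for x t
    proof -
      have c: "continuous_on {0..T} (\<lambda>s. f s (X x s))"
        using contV[of "V x"] by (simp add: X_def)
      have "((\<lambda>t. x + integral {0..t} (\<lambda>s. f s (X x s))) has_vector_derivative f t (X x t)) (at t within {0..T})"
        using integral_has_vector_derivative[OF c t] by (auto intro!: derivative_eq_intros)
      from has_vector_derivative_transform[OF t _ this, of "X x"] show ?thesis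
        using Xeq by blast
    qed
    have start: "dist (Psi x W) (Psi x' W) \<le> dist x x'" for x x' W
    proof (rule dist_bound)
      fix t0
      have "exp (-2 * K * clamp 0 T t0) \<le> 1" using K cl[of t0] by auto
      then have "exp (-2 * K * clamp 0 T t0) * norm (x - x') \<le> 1 * norm (x - x')"
        by (intro mult_right_mono) auto
      then show "dist (apply_bcontfun (Psi x W) t0) (apply_bcontfun (Psi x' W) t0) \<le> dist x x'"
        by (simp add: Psi P_def dist_norm flip: scaleR_diff_right)
    qed
    have VV: "dist (V x) (V x') \<le> 2 * dist x x'" for x x'
    proof -
      have "dist (V x) (V x') \<le> dist (Psi x (V x)) (Psi x (V x')) + dist (Psi x (V x')) (Psi x' (V x'))"
        using dist_triangle[of "Psi x (V x)" "Psi x' (V x')" "Psi x (V x')"] by (simp add: V)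
      also have "\<dots> \<le> 1/2 * dist (V x) (V x') + dist x x'"
        by (intro add_mono contr start)
      finally show ?thesis by simp
    qed
    have "dist (X x T) (X x' T) \<le> exp (2 * K * T) * (2 * dist x x')" for x x'
    proof -
      have "dist (X x T) (X x' T) = exp (2 * K * T) * dist (apply_bcontfun (V x) T) (apply_bcontfun (V x') T)"
        by (simp add: X_def dist_norm flip: scaleR_diff_right)
      also have "\<dots> \<le> exp (2 * K * T) * (2 * dist x x')"
        by (intro mult_left_mono order_trans[OF dist_bounded VV]) auto
      finally show ?thesis .
    qed
    then have "(exp (2 * K * T) * 2)-lipschitz_on UNIV (\<lambda>x. X x T)"
      by (auto simp: lipschitz_on_def mult.assoc)
    then show "continuous_on UNIV (\<lambda>x. X x T)"
      by (rule lipschitz_on_continuous_on)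
  qed
qed

section \<open>Zeros of planar maps on a rectangle\<close>

text \<open>
  In the Poincare-Miranda theorem both components have prescribed signs on opposite edges. It is enough
  to know the sign of the second one where the first one vanishes: at a fixed point of the map below the
  horizontal edge conditions already force \<open>F1 = 0\<close>, and only then are the vertical edges looked at.
\<close>
lemma rectangle_zero:
  fixes F1 F2 :: "real \<Rightarrow> real \<Rightarrow> real"
  assumes ab: "a \<le> b" and cd: "c \<le> d"
    and c1: "continuous_on UNIV (\<lambda>(x, y). F1 x y)"
    and c2: "continuous_on UNIV (\<lambda>(x, y). F2 x y)"
    and bot: "\<And>x. x \<in> {a..b} \<Longrightarrow> F1 x c \<le> 0"
    and top: "\<And>x. x \<in> {a..b} \<Longrightarrow> F1 x d \<ge> 0"
    and left: "\<And>y. y \<in> {c..d} \<Longrightarrow> F1 a y = 0 \<Longrightarrow> F2 a y \<ge> 0"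
    and right: "\<And>y. y \<in> {c..d} \<Longrightarrow> F1 b y = 0 \<Longrightarrow> F2 b y \<le> 0"
  obtains x y where "x \<in> {a..b}" "y \<in> {c..d}" "F1 x y = 0" "F2 x y = 0"
proof -
  \<comment> \<open>Before clamping, the displacement \<open>(F2, - F1)\<close> points inwards on every edge on which its sign is known.\<close>
  define h where "h = (\<lambda>(x, y). (max a (min b (x + F2 x y)), max c (min d (y - F1 x y))))"
  have c1': "continuous_on S (\<lambda>z. F1 (fst z) (snd z))" for S
    using c1 by (auto simp: case_prod_unfold intro: continuous_on_subset)
  have c2': "continuous_on S (\<lambda>z. F2 (fst z) (snd z))" for S
    using c2 by (auto simp: case_prod_unfold intro: continuous_on_subset)
  obtain z where z: "z \<in> {a..b} \<times> {c..d}" "h z = z"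
  proof (rule brouwer[of "{a..b} \<times> {c..d}" h])
    show "continuous_on ({a..b} \<times> {c..d}) h"
      unfolding h_def case_prod_unfold by (intro continuous_intros c1' c2')
    show "h \<in> {a..b} \<times> {c..d} \<rightarrow> {a..b} \<times> {c..d}"
      using ab cd by (auto simp: h_def)
  qed (use ab cd in \<open>auto intro: compact_Times convex_Times\<close>)
  obtain x y where xy: "z = (x, y)" by (cases z)
  have x: "x \<in> {a..b}" "max a (min b (x + F2 x y)) = x"
    and y: "y \<in> {c..d}" "max c (min d (y - F1 x y)) = y"
    using z by (auto simp: xy h_def)
  have "F1 x y = 0"
    using y bot[OF x(1)] top[OF x(1)] by (auto simp: max_def min_def split: if_splits)
  moreover from this have "F2 x y = 0"
    using x left[OF y(1)] right[OF y(1)] by (auto simp: max_def min_def split: if_splits)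
  ultimately show thesis using that x y by auto
qed

section \<open>Momentum and velocity\<close>

text \<open>
  The inverse of \<open>v \<mapsto> v / sqrt (1 - v\<^sup>2)\<close>; see \<open>velocity_inverse\<close>.
\<close>
definition velocity :: "real \<Rightarrow> real" where
  "velocity y = y / sqrt (1 + y\<^sup>2)"

lemma sqrt_one_plus_square_pos: "sqrt (1 + y\<^sup>2) > 0" for y :: real
  by (smt (verit) real_sqrt_gt_zero zero_le_power2)

lemma velocity_sgn: "velocity y > 0 \<longleftrightarrow> y > 0" "velocity y < 0 \<longleftrightarrow> y < 0" "velocity y = 0 \<longleftrightarrow> y = 0"
  using sqrt_one_plus_square_pos[of y] by (auto simp: velocity_def zero_less_divide_iff divide_less_0_iff)

lemma velocity_abs_less_1: "\<bar>velocity y\<bar> < 1"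
proof -
  have "\<bar>y\<bar> < sqrt (1 + y\<^sup>2)"
    by (rule real_less_rsqrt) simp
  then show ?thesis using sqrt_one_plus_square_pos[of y] by (simp add: velocity_def abs_divide)
qed

lemma velocity_abs_le: "\<bar>velocity y\<bar> \<le> \<bar>y\<bar>"
proof -
  have "1 \<le> sqrt (1 + y\<^sup>2)" by simp
  then have "\<bar>y\<bar> / sqrt (1 + y\<^sup>2) \<le> \<bar>y\<bar>"
    using mult_left_mono[of 1 "sqrt (1 + y\<^sup>2)" "\<bar>y\<bar>"] sqrt_one_plus_square_pos[of y]
    by (simp only: pos_divide_le_eq mult_1_right abs_ge_zero simp_thms)
  then show ?thesis using sqrt_one_plus_square_pos[of y] by (simp add: velocity_def abs_divide)
qed

lemma velocity_minus: "velocity (-y) = - velocity y"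
  by (simp add: velocity_def)

text \<open>
  A momentum of size one moves \<open>u\<close> at speed at least \<open>1/2\<close>; this converts large momentum into a
  definite change of height.
\<close>
lemma velocity_ge_half:
  assumes "y \<ge> 1"
  shows "velocity y \<ge> 1/2"
proof -
  have "1 + y\<^sup>2 \<le> (2 * y)\<^sup>2"
    using one_le_power[OF assms, of 2] by (simp add: power_mult_distrib)
  then have "sqrt (1 + y\<^sup>2) \<le> 2 * y"
    by (rule real_le_lsqrt[rotated -1]) (use assms in auto)
  then show ?thesis using sqrt_one_plus_square_pos[of y] by (simp add: velocity_def field_simps)
qed

lemma DERIV_velocity: "(velocity has_real_derivative 1 / (sqrt (1 + y\<^sup>2) * (1 + y\<^sup>2))) (at y)"
proof -
  have p: "1 + y\<^sup>2 > 0" by (smt (verit) zero_le_power2)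
  have q: "sqrt (1 + y\<^sup>2) * sqrt (1 + y\<^sup>2) = 1 + y\<^sup>2" using p by simp
  have "((\<lambda>y. y / sqrt (1 + y\<^sup>2)) has_real_derivative 1 / (sqrt (1 + y\<^sup>2) * (1 + y\<^sup>2))) (at y)"
    using p q by (auto intro!: derivative_eq_intros simp: divide_simps) (simp_all add: algebra_simps power2_eq_square)
  then show ?thesis by (simp add: velocity_def[abs_def])
qed

lemma velocity_lipschitz: "\<bar>velocity x - velocity y\<bar> \<le> \<bar>x - y\<bar>"
proof -
  have "norm (velocity x - velocity y) \<le> 1 * norm (x - y)"
  proof (rule field_differentiable_bound[of UNIV])
    show "(velocity has_field_derivative 1 / (sqrt (1 + y\<^sup>2) * (1 + y\<^sup>2))) (at y within UNIV)" for y
      using DERIV_velocity by simp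
    show "norm (1 / (sqrt (1 + y\<^sup>2) * (1 + y\<^sup>2))) \<le> 1" for y :: real
    proof -
      have "1 * 1 \<le> sqrt (1 + y\<^sup>2) * (1 + y\<^sup>2)" by (intro mult_mono) auto
      then show ?thesis by (simp add: abs_mult)
    qed
  qed auto
  then show ?thesis by simp
qed

lemma continuous_on_velocity [continuous_intros]:
  "continuous_on S f \<Longrightarrow> continuous_on S (\<lambda>x. velocity (f x))"
  unfolding velocity_def by (intro continuous_intros) (use sqrt_one_plus_square_pos in \<open>auto simp: less_le\<close>)

lemma velocity_inverse: "velocity y / sqrt (1 - (velocity y)\<^sup>2) = y"
proof -
  have p: "1 + y\<^sup>2 > 0" by (smt (verit) zero_le_power2)
  have "1 - (velocity y)\<^sup>2 = 1 / (1 + y\<^sup>2)"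
    using p by (simp add: velocity_def power_divide field_simps)
  then show ?thesis using p by (simp add: velocity_def real_sqrt_divide)
qed

lemma velocity_le: "y \<le> c \<Longrightarrow> 0 \<le> c \<Longrightarrow> velocity y \<le> c"
  using velocity_abs_le[of y] velocity_sgn(1)[of y] by (cases "y \<le> 0") auto

section \<open>One-variable calculus\<close>

lemma increment_le:
  fixes f f' :: "real \<Rightarrow> real"
  assumes "s \<le> t"
    and "\<And>x. x \<in> {s..t} \<Longrightarrow> (f has_real_derivative f' x) (at x within {s..t})"
    and "\<And>x. x \<in> {s<..<t} \<Longrightarrow> f' x \<le> c"
  shows "f t - f s \<le> c * (t - s)"
proof (cases "s = t")
  case False
  then obtain x where "x \<in> {s<..<t}" "f t - f s = f' x * (t - s)"
    using mvt_simple[of s t f "\<lambda>x h. f' x * h"] assms(1,2)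
    by (auto simp: has_field_derivative_def)
  then show ?thesis using assms by (auto intro!: mult_right_mono)
qed auto

lemma first_zero:
  fixes f :: "real \<Rightarrow> real"
  assumes "continuous_on {p..q} f" "f p < 0" "t \<in> {p..q}" "f t \<ge> 0"
  obtains t1 where "p < t1" "t1 \<le> t" "f t1 = 0" "\<And>s. s \<in> {p..<t1} \<Longrightarrow> f s < 0"
proof -
  define S where "S = {s \<in> {p..t}. f s \<ge> 0}"
  have c: "continuous_on {p..t} f" by (rule continuous_on_subset[OF assms(1)]) (use assms in auto)
  have "closed S"
    unfolding S_def by (rule continuous_on_closed_Collect_le[OF continuous_on_const c closed_atLeastAtMost]) 
  moreover have "bounded S"
    by (rule bounded_subset[OF bounded_closed_interval[of p t]]) (auto simp: S_def)
  ultimately have "compact S" by (simp add: compact_eq_bounded_closed)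
  moreover have "t \<in> S" using assms by (auto simp: S_def)
  ultimately obtain t1 where t1: "t1 \<in> S" "\<And>s. s \<in> S \<Longrightarrow> t1 \<le> s"
    using compact_attains_inf[of S] by blast
  have lt: "f s < 0" if "s \<in> {p..<t1}" for s
  proof (rule ccontr)
    assume "\<not> f s < 0"
    then have "s \<in> S" using that t1(1) by (auto simp: S_def)
    then show False using t1(2) that by fastforce
  qed
  have "\<exists>x\<ge>p. x \<le> t1 \<and> f x = 0"
    by (rule IVT') (use t1(1) assms c in \<open>auto simp: S_def intro: continuous_on_subset\<close>)
  then obtain x where x: "x \<ge> p" "x \<le> t1" "f x = 0" by blast
  then have "x = t1" using lt[of x] by force
  then show thesis using that[of t1] lt x t1(1) assms(2) by (auto simp: S_def less_le)
qed

section \<open>Orbits and elementary estimates\<close>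

text \<open>
  Solutions of the planar system on one period. The derivatives are one-sided at the end points.
\<close>
definition orbit :: "real \<Rightarrow> (real \<Rightarrow> real) \<Rightarrow> (real \<Rightarrow> real) \<Rightarrow> (real \<Rightarrow> real) \<Rightarrow> (real \<Rightarrow> real) \<Rightarrow> bool" where
  "orbit T a g u y \<longleftrightarrow> (\<forall>t\<in>{0..T}.
     (u has_real_derivative velocity (y t)) (at t within {0..T}) \<and>
     (y has_real_derivative - (a t * g (u t))) (at t within {0..T}))"

text \<open>
  The properties of the nonlinearity that the argument needs, after its continuation by \<open>0\<close>. Superlinearity
  at \<open>0\<close> appears in the form that the Lipschitz constant on \<open>{..r}\<close> becomes arbitrarily small; this
  controls both the size of \<open>g\<close> and its oscillation. The condition \<open>a 0 > 0\<close> can be reached by a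
  shift of time when \<open>a\<close> is periodic and positive somewhere.
\<close>
locale indefinite_problem =
  fixes T :: real and a g :: "real \<Rightarrow> real"
  assumes T_pos: "T > 0"
    and a_cont: "continuous_on UNIV a"
    and a_zeros: "finite {t \<in> {0..T}. a t = 0}"
    and a_start: "a 0 > 0"
    and a_mean: "integral {0..T} a < 0"
    and g_nonpos: "\<And>x. x \<le> 0 \<Longrightarrow> g x = 0"
    and g_pos: "\<And>x. x > 0 \<Longrightarrow> g x > 0"
    and g_mono: "mono g"
    and g_lipschitz: "\<And>K. \<exists>L. L-lipschitz_on {..K} g"
    and g_small: "\<And>e. e > 0 \<Longrightarrow> \<exists>r>0. e-lipschitz_on {..r} g"
    and g_growth: "\<And>h k. h > 0 \<Longrightarrow> eventually (\<lambda>x. k * g x \<le> g (x + h)) at_top"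
    and g_at_top: "filterlim g at_top at_top"
begin

definition A :: real where "A = Sup ((\<lambda>t. \<bar>a t\<bar>) ` {0..T})"

definition mass :: "real \<Rightarrow> real" where "mass t = integral {0..t} a"

lemma a_le_A: "t \<in> {0..T} \<Longrightarrow> \<bar>a t\<bar> \<le> A"
  unfolding A_def
  by (intro cSup_upper bounded_imp_bdd_above compact_imp_bounded compact_continuous_image
      continuous_intros imageI) (auto intro: continuous_on_subset[OF a_cont])

lemma A_pos: "A > 0"
  using a_le_A[of 0] a_start T_pos by auto

lemma g_nonneg: "g x \<ge> 0"
  using g_nonpos[of x] g_pos[of x] by (cases "x \<le> 0") auto

lemma g_le: "x \<le> y \<Longrightarrow> g x \<le> g y"
  using g_mono by (auto dest: monoD)

lemma DERIV_mass:
  assumes "t \<in> {0..T}" "{s..s'} \<subseteq> {0..T}"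
  shows "(mass has_real_derivative a t) (at t within {s..s'})"
proof -
  have "(mass has_real_derivative a t) (at t within {0..T})"
    unfolding mass_def[abs_def] has_real_derivative_iff_has_vector_derivative
    by (rule integral_has_vector_derivative) (use assms in \<open>auto intro: continuous_on_subset[OF a_cont]\<close>)
  then show ?thesis by (rule has_field_derivative_subset) (use assms in auto)
qed

context
  fixes u y :: "real \<Rightarrow> real"
  assumes orb: "orbit T a g u y"
begin

lemma DERIV_u:
  "t \<in> {s..s'} \<Longrightarrow> {s..s'} \<subseteq> {0..T} \<Longrightarrow> (u has_real_derivative velocity (y t)) (at t within {s..s'})"
  using orb unfolding orbit_def by (blast intro: has_field_derivative_subset)

lemma DERIV_y:
  "t \<in> {s..s'} \<Longrightarrow> {s..s'} \<subseteq> {0..T} \<Longrightarrow> (y has_real_derivative - (a t * g (u t))) (at t within {s..s'})"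
  using orb unfolding orbit_def by (blast intro: has_field_derivative_subset)

lemma cont_u: "{s..s'} \<subseteq> {0..T} \<Longrightarrow> continuous_on {s..s'} u"
  by (rule DERIV_continuous_on) (rule DERIV_u)

lemma cont_y: "{s..s'} \<subseteq> {0..T} \<Longrightarrow> continuous_on {s..s'} y"
  by (rule DERIV_continuous_on) (rule DERIV_y)

lemma u_increment_le:
  assumes "0 \<le> s" "s \<le> t" "t \<le> T" "\<And>x. x \<in> {s<..<t} \<Longrightarrow> velocity (y x) \<le> c"
  shows "u t - u s \<le> c * (t - s)"
  by (rule increment_le[of s t u "\<lambda>x. velocity (y x)"]) (use assms in \<open>auto intro!: DERIV_u\<close>)

lemma u_increment_ge:
  assumes "0 \<le> s" "s \<le> t" "t \<le> T" "\<And>x. x \<in> {s<..<t} \<Longrightarrow> c \<le> velocity (y x)"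
  shows "c * (t - s) \<le> u t - u s"
proof -
  have "- u t - - u s \<le> - c * (t - s)"
  proof (rule increment_le[of s t "\<lambda>x. - u x" "\<lambda>x. - velocity (y x)"])
    show "((\<lambda>x. - u x) has_real_derivative - velocity (y x)) (at x within {s..t})" if "x \<in> {s..t}" for x
      by (intro DERIV_minus DERIV_u) (use that assms in auto)
  qed (use assms in auto)
  then show ?thesis by simp
qed

lemma u_nonincreasing:
  assumes "0 \<le> s" "s \<le> t" "t \<le> T" "\<And>x. x \<in> {s<..<t} \<Longrightarrow> y x \<le> 0"
  shows "u t \<le> u s"
proof -
  have "velocity (y x) \<le> 0" if "x \<in> {s<..<t}" for x
    using assms(4)[OF that] velocity_sgn(1)[of "y x"] by linarith
  then show ?thesis using u_increment_le[of s t 0] assms by auto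
qed

lemma u_nondecreasing:
  assumes "0 \<le> s" "s \<le> t" "t \<le> T" "\<And>x. x \<in> {s<..<t} \<Longrightarrow> y x \<ge> 0"
  shows "u s \<le> u t"
proof -
  have "0 \<le> velocity (y x)" if "x \<in> {s<..<t}" for x
    using assms(4)[OF that] velocity_sgn(2)[of "y x"] by linarith
  then show ?thesis using u_increment_ge[of s t 0] assms by auto
qed

lemma u_mean_value:
  assumes "0 \<le> s" "s < t" "t \<le> T"
  obtains x where "x \<in> {s<..<t}" "u t - u s = velocity (y x) * (t - s)"
  using mvt_simple[of s t u "\<lambda>x h. velocity (y x) * h"] assms DERIV_u[of _ s t]
  by (auto simp: has_field_derivative_def)

lemma u_lipschitz:
  assumes "s \<in> {0..T}" "t \<in> {0..T}"
  shows "\<bar>u t - u s\<bar> \<le> \<bar>t - s\<bar>"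
proof -
  have velocity1: "-1 \<le> velocity (y x)" "velocity (y x) \<le> 1" for x
    using velocity_abs_less_1[of "y x"] by auto
  have *: "\<bar>u t - u s\<bar> \<le> t - s" if "0 \<le> s" "s \<le> t" "t \<le> T" for s t
    using u_increment_le[OF that velocity1(2)] u_increment_ge[OF that velocity1(1)] by (simp add: abs_le_iff)
  show ?thesis using *[of s t] *[of t s] assms by (cases "s \<le> t") auto
qed

lemma y_increment_abs:
  assumes "0 \<le> s" "s \<le> t" "t \<le> T" "\<And>x. x \<in> {s..t} \<Longrightarrow> u x \<le> c"
  shows "\<bar>y t - y s\<bar> \<le> A * g c * (t - s)"
proof -
  have b: "\<bar>a x * g (u x)\<bar> \<le> A * g c" if "x \<in> {s<..<t}" for x
    unfolding abs_mult using that assms a_le_A[of x] g_nonneg[of "u x"] g_le[OF assms(4)[of x]] A_pos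
    by (intro mult_mono) auto
  have "y t - y s \<le> A * g c * (t - s)"
    by (rule increment_le[of s t y "\<lambda>x. - (a x * g (u x))"])
      (use assms b in \<open>auto intro!: DERIV_y simp: abs_le_iff\<close>)
  moreover have "- y t - - y s \<le> A * g c * (t - s)"
  proof (rule increment_le[of s t "\<lambda>x. - y x" "\<lambda>x. - (- (a x * g (u x)))"])
    show "((\<lambda>x. - y x) has_real_derivative - (- (a x * g (u x)))) (at x within {s..t})"
      if "x \<in> {s..t}" for x
      by (intro DERIV_minus DERIV_y) (use that assms in auto)
  qed (use assms b in \<open>auto simp: abs_le_iff\<close>)
  ultimately show ?thesis by auto
qed

text \<open>
  Compare \<open>a g(u)\<close> with \<open>g(c) a\<close> on a stretch where \<open>a\<close> is nonnegative and integrate the difference.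
\<close>
lemma y_decrement:
  assumes "0 \<le> s" "s \<le> t" "t \<le> T" "\<And>x. x \<in> {s..t} \<Longrightarrow> a x \<ge> 0" "\<And>x. x \<in> {s..t} \<Longrightarrow> c \<le> u x"
  shows "y t \<le> y s - g c * (mass t - mass s)"
proof -
  have "(y t + g c * mass t) - (y s + g c * mass s) \<le> 0 * (t - s)"
  proof (rule increment_le[of s t "\<lambda>t. y t + g c * mass t" "\<lambda>x. - (a x * g (u x)) + g c * a x"])
    show "((\<lambda>t. y t + g c * mass t) has_real_derivative - (a x * g (u x)) + g c * a x) (at x within {s..t})"
      if "x \<in> {s..t}" for x
      using that assms by (auto intro!: derivative_eq_intros DERIV_y DERIV_mass)
    show "- (a x * g (u x)) + g c * a x \<le> 0" if "x \<in> {s<..<t}" for x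
      using that assms(4)[of x] g_le[OF assms(5)[of x]] mult_left_mono[of "g c" "g (u x)" "a x"]
      by (auto simp: mult.commute)
  qed (use assms in auto)
  then show ?thesis by (simp add: algebra_simps)
qed

lemma y_nonincreasing:
  assumes "0 \<le> s" "s \<le> t" "t \<le> T" "\<And>x. x \<in> {s..t} \<Longrightarrow> a x \<ge> 0"
  shows "y t \<le> y s"
proof -
  have "y t - y s \<le> 0 * (t - s)"
    by (rule increment_le[of s t y "\<lambda>x. - (a x * g (u x))"])
      (use assms g_nonneg in \<open>auto intro!: DERIV_y\<close>)
  then show ?thesis by simp
qed

end

end

section \<open>Orbits starting far from the origin\<close>

context indefinite_problem
begin

text \<open>
  The admissible left end points form a compact set, on which the continuous integral of \<open>a\<close> attains its
  minimum. That minimum is not zero because \<open>a\<close> has only finitely many zeros.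
\<close>
lemma uniform_positive_mass:
  assumes h: "h > 0" 
  obtains m where "m > 0"
    "\<And>s. 0 \<le> s \<Longrightarrow> s + h \<le> T \<Longrightarrow> (\<And>t. t \<in> {s..s+h} \<Longrightarrow> a t \<ge> 0) \<Longrightarrow> m \<le> mass (s + h) - mass s"
proof -
  define S where "S = {0..T-h} \<inter> (\<Inter>r\<in>{0..h}. {s. a (s + r) \<ge> 0})"
  have "closed S"
    unfolding S_def
    by (intro closed_Int closed_atLeastAtMost closed_INT ballI closed_Collect_le continuous_intros
        continuous_on_compose2[OF a_cont]) auto
  moreover have "bounded S"
    by (rule bounded_subset[OF bounded_closed_interval[of 0 "T-h"]]) (auto simp: S_def)
  ultimately have S: "compact S" by (simp add: compact_eq_bounded_closed)
  have memS: "s \<in> S" if "0 \<le> s" "s + h \<le> T" "\<And>t. t \<in> {s..s+h} \<Longrightarrow> a t \<ge> 0" for s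
    using that by (auto simp: S_def)
  show thesis
  proof (cases "S = {}")
    case True
    show ?thesis
    proof (rule that[of 1])
      fix s assume "0 \<le> s" "s + h \<le> T" "\<And>t. t \<in> {s..s+h} \<Longrightarrow> a t \<ge> 0"
      then have "s \<in> S" by (rule memS)
      then show "1 \<le> mass (s + h) - mass s" using True by blast
    qed simp
  next
    case False
    have int: "a integrable_on {s..t}" for s t
      by (rule integrable_continuous_real) (rule continuous_on_subset[OF a_cont], simp)
    have contm: "continuous_on {0..T} mass"
      unfolding mass_def[abs_def] by (rule indefinite_integral_continuous_1[OF int])
    have "continuous_on S (\<lambda>s. mass (s + h) - mass s)"
      by (intro continuous_intros continuous_on_compose2[OF contm] continuous_on_subset[OF contm])
        (use h in \<open>auto simp: S_def\<close>)
    then obtain s where s: "s \<in> S" "\<And>r. r \<in> S \<Longrightarrow> mass (s + h) - mass s \<le> mass (r + h) - mass r"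
      using continuous_attains_inf[OF S False] by blast
    have nn: "a t \<ge> 0" if "t \<in> {s..s+h}" for t
    proof -
      have "t - s \<in> {0..h}" using that by auto
      then have "a (s + (t - s)) \<ge> 0" using s(1) unfolding S_def by blast
      then show ?thesis by simp
    qed
    have s0: "0 \<le> s" "s + h \<le> T" using s(1) by (auto simp: S_def)
    have eq: "mass (s + h) - mass s = integral {s..s+h} a"
      using Henstock_Kurzweil_Integration.integral_combine[OF _ _ int, of 0 s "s+h"] s0 h by (simp add: mass_def)
    have "integral {s..s+h} a \<noteq> 0"
    proof
      assume "integral {s..s+h} a = 0"
      moreover have "continuous_on {s..s+h} a" using a_cont by (rule continuous_on_subset) simp
      ultimately have "\<forall>t\<in>{s..s+h}. a t = 0"
        using integral_eq_0_iff[of s "s+h" a] nn h by simp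
      then have "{s..s+h} \<subseteq> {t \<in> {0..T}. a t = 0}" using s0 by auto
      then have "finite {s..s+h}" using a_zeros by (rule finite_subset)
      then show False using h by (simp add: infinite_Icc)
    qed
    moreover have "integral {s..s+h} a \<ge> 0" using nn by (intro integral_nonneg int) auto
    ultimately have "mass (s + h) - mass s > 0" using eq by simp
    then show ?thesis using that s(2) memS by blast
  qed
qed

text \<open>
  Without a zero in between, one positive value fixes the sign, by the intermediate value theorem.
\<close>
lemma nonneg_between:
  assumes "x \<in> {s<..<t}" "a x > 0" "\<And>r. r \<in> {s<..<t} \<Longrightarrow> a r \<noteq> 0" "r \<in> {s..t}"
  shows "a r \<ge> 0"
proof -
  have st: "s < t" using assms(1) by auto
  have cont: "continuous_on S a" for S using a_cont by (rule continuous_on_subset) simp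
  have "a q \<ge> 0" if q: "q \<in> {s<..<t}" for q
  proof (rule ccontr)
    assume neg: "\<not> a q \<ge> 0"
    have "\<exists>z \<in> {s<..<t}. a z = 0"
    proof (cases "q \<le> x")
      case True
      then show ?thesis using IVT'[of a q 0 x] neg assms(1,2) q cont by force
    next
      case False
      then show ?thesis using IVT2'[of a q 0 x] neg assms(1,2) q cont by force
    qed
    then show False using assms(3) by auto
  qed
  then show ?thesis
    using continuous_ge_on_closure[of "{s<..<t}" a r 0] cont st assms(4) by simp
qed

text \<open>
  A length \<open>h\<close> so small that a window of length \<open>4 h\<close> contains at most one zero of \<open>a\<close>, and
  that \<open>a\<close> is still positive on the first such window.
\<close>
lemma zero_isolation:
  obtains h where "h > 0" "4 * h \<le> T" "\<And>t. t \<in> {0..4*h} \<Longrightarrow> a t > 0"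
    "\<And>z z'. z \<in> {0..T} \<Longrightarrow> z' \<in> {0..T} \<Longrightarrow> a z = 0 \<Longrightarrow> a z' = 0 \<Longrightarrow> \<bar>z - z'\<bar> < 4 * h \<Longrightarrow> z = z'"
proof -
  let ?Z = "{t \<in> {0..T}. a t = 0}"
  obtain d where d: "d > 0" "\<And>z z'. z \<in> ?Z \<Longrightarrow> z' \<in> ?Z \<Longrightarrow> dist z z' < d \<Longrightarrow> z = z'"
  proof -
    have "\<exists>e>0. \<forall>x\<in>?Z. x \<noteq> z \<longrightarrow> e \<le> dist z x" for z
      by (rule finite_set_avoid[OF a_zeros])
    then obtain e where e: "\<And>z. e z > 0" "\<And>z x. x \<in> ?Z \<Longrightarrow> x \<noteq> z \<Longrightarrow> e z \<le> dist z x" by metis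
    show thesis
    proof (rule that[of "Min (insert 1 (e ` ?Z))"])
      show "Min (insert 1 (e ` ?Z)) > 0" using a_zeros e(1) by (subst Min_gr_iff) auto
      fix z z' assume *: "z \<in> ?Z" "z' \<in> ?Z" "dist z z' < Min (insert 1 (e ` ?Z))"
      have "Min (insert 1 (e ` ?Z)) \<le> e z" using a_zeros *(1) by (intro Min_le) auto
      then show "z = z'" using e(2)[of z' z] * by force
    qed
  qed
  have "isCont a 0" using a_cont by (simp add: continuous_on_eq_continuous_at)
  then have "eventually (\<lambda>t. a t > 0) (nhds 0)"
    using a_start by (simp add: isCont_def tendsto_at_iff_tendsto_nhds order_tendstoD(1))
  then obtain e where e: "e > 0" "\<And>t. dist t 0 < e \<Longrightarrow> a t > 0"
    by (auto simp: eventually_nhds_metric)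
  define h where "h = min (min (d/4) (e/8)) (T/4)"
  show thesis
  proof (rule that[of h])
    show "h > 0" "4 * h \<le> T" using d(1) e(1) T_pos by (auto simp: h_def)
    show "a t > 0" if "t \<in> {0..4*h}" for t
      using that e by (auto simp: h_def dist_real_def)
    show "z = z'" if "z \<in> {0..T}" "z' \<in> {0..T}" "a z = 0" "a z' = 0" "\<bar>z - z'\<bar> < 4 * h" for z z'
      using that d(2)[of z z'] by (auto simp: h_def dist_real_def)
  qed
qed

text \<open>
  The momentum lost at height \<open>x + h\<close> on a stretch of mass \<open>m\<close> outweighs the largest change,
  \<open>A * T * g x\<close>, that can happen below height \<open>x\<close> within a period. The factor \<open>2\<close> leaves room for
  one such change on either side of an inequality.
\<close>
lemma growth_threshold:
  assumes h: "h > 0" and m: "m > 0"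
  obtains X where "X > 0" "\<And>x. x \<ge> X \<Longrightarrow> m * g x \<ge> 1"
    "\<And>x. x \<ge> X \<Longrightarrow> 2 * (A * T * g x) < m * g (x + h)"
proof -
  have "eventually (\<lambda>x. (2 * A * T + 1) / m * g x \<le> g (x + h)) at_top"
    by (rule g_growth[OF h])
  moreover have "eventually (\<lambda>x. 1 / m \<le> g x) at_top"
    using g_at_top by (simp add: filterlim_at_top)
  ultimately have "eventually (\<lambda>x. (2 * A * T + 1) / m * g x \<le> g (x + h) \<and> 1 / m \<le> g x) at_top"
    by eventually_elim simp
  then obtain X where X: "\<And>x. x \<ge> X \<Longrightarrow> (2 * A * T + 1) / m * g x \<le> g (x + h)" "\<And>x. x \<ge> X \<Longrightarrow> 1 / m \<le> g x"
    by (auto simp: eventually_at_top_linorder)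
  show thesis
  proof (rule that[of "max X 1"])
    fix x assume x: "x \<ge> max X 1"
    show "m * g x \<ge> 1" using X(2)[of x] x m by (simp add: field_simps)
    have "m * ((2 * A * T + 1) / m * g x) \<le> m * g (x + h)"
      using X(1)[of x] x m by (intro mult_left_mono) auto
    moreover have "m * ((2 * A * T + 1) / m * g x) = 2 * (A * T * g x) + g x"
      using m by (simp add: field_simps)
    moreover have "g x > 0" using x by (intro g_pos) simp
    ultimately show "2 * (A * T * g x) < m * g (x + h)" by linarith
  qed simp
qed

text \<open>
  The constants that the lemmas \<open>zero_isolation\<close>, \<open>uniform_positive_mass\<close> and \<open>growth_threshold\<close>
  provide stay fixed in the study of large orbits; \<open>X\<close> is a threshold for \<open>h/2\<close>, the height that is
  certainly climbed or lost during a time \<open>h\<close> of large momentum.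
\<close>
context
  fixes h m X :: real
  assumes h_pos: "h > 0" and h_le: "4 * h \<le> T"
    and a_init: "\<And>t. t \<in> {0..4*h} \<Longrightarrow> a t > 0"
    and gap: "\<And>z z'. z \<in> {0..T} \<Longrightarrow> z' \<in> {0..T} \<Longrightarrow> a z = 0 \<Longrightarrow> a z' = 0 \<Longrightarrow> \<bar>z - z'\<bar> < 4 * h \<Longrightarrow> z = z'"
    and m_pos: "m > 0"
    and mass_ge: "\<And>s. 0 \<le> s \<Longrightarrow> s + h \<le> T \<Longrightarrow> (\<And>t. t \<in> {s..s+h} \<Longrightarrow> a t \<ge> 0) \<Longrightarrow> m \<le> mass (s + h) - mass s"
    and X_pos: "X > 0"
    and X_slope: "\<And>x. x \<ge> X \<Longrightarrow> m * g x \<ge> 1"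
    and X_growth: "\<And>x. x \<ge> X \<Longrightarrow> 2 * (A * T * g x) < m * g (x + h/2)"
begin

lemma momentum_drop:
  assumes orb: "orbit T a g u y"
    and s: "0 \<le> s" "s + h \<le> T" "\<And>t. t \<in> {s..s+h} \<Longrightarrow> a t \<ge> 0"
    and u: "\<And>t. t \<in> {s..s+h} \<Longrightarrow> c \<le> u t"
  shows "y (s + h) \<le> y s - m * g c"
proof -
  have "y (s + h) \<le> y s - g c * (mass (s + h) - mass s)"
    by (rule y_decrement[OF orb]) (use s u h_pos in auto)
  also have "\<dots> \<le> y s - g c * m"
    using mass_ge[OF s] g_nonneg by (intro diff_left_mono mult_left_mono) auto
  finally show ?thesis by (simp add: mult.commute)
qed

text \<open>
  During the first \<open>h\<close> units of time the momentum drops below \<open>- m g(x)\<close>, where \<open>x\<close> is the height reached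
  then. During the next \<open>h\<close> units \<open>u\<close> falls by at least \<open>h/2\<close>. From there on the momentum could
  recover by at most \<open>A T g(x - h/2)\<close>, which is less than \<open>m g(x)\<close>.
\<close>
lemma large_orbit_keeps_falling:
  assumes orb: "orbit T a g u y"
    and s: "0 \<le> s" "s < T" and us: "u s \<ge> X + 2 * T" and ys: "y s \<le> 0"
    and as: "\<And>t. t \<in> {s..min T (s + 2 * h)} \<Longrightarrow> a t \<ge> 0"
  shows "\<And>t. t \<in> {s..T} \<Longrightarrow> y t \<le> 0"
    and "s + 2 * h \<le> T \<Longrightarrow> u T \<le> u s - h/2"
proof -
  have early: "y t \<le> 0" if "t \<in> {s..min T (s + 2 * h)}" for t
  proof -
    have "y t \<le> y s"
      by (rule y_nonincreasing[OF orb]) (use that s as in auto)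
    then show ?thesis using ys by simp
  qed
  have main: "(\<forall>t\<in>{s..T}. y t \<le> 0) \<and> u T \<le> u s - h/2" if sT: "s + 2 * h \<le> T"
  proof -
    define x where "x = u (s + h)"
    have x: "x \<ge> X + T" using u_lipschitz[OF orb, of s "s + h"] us s sT h_pos h_le by (auto simp: x_def)
    have xs: "x \<le> u s"
      unfolding x_def by (rule u_nonincreasing[OF orb]) (use early s sT h_pos in auto)
    have "y (s + h) \<le> y s - m * g x"
    proof (rule momentum_drop[OF orb])
      show "x \<le> u t" if "t \<in> {s..s+h}" for t
        unfolding x_def by (rule u_nonincreasing[OF orb]) (use that early s sT h_pos in auto)
    qed (use s sT h_pos as in auto)
    then have yh: "y (s + h) \<le> - (m * g x)" using ys by simp
    have yt: "y t \<le> - (m * g x)" if "t \<in> {s+h..s+2*h}" for t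
    proof -
      have "y t \<le> y (s + h)"
        by (rule y_nonincreasing[OF orb]) (use that as s sT h_pos in auto)
      then show ?thesis using yh by simp
    qed
    have mg: "m * g x \<ge> 1" using X_slope x T_pos by simp
    have u2: "u (s + 2 * h) \<le> x - h/2"
    proof -
      have "velocity (y t) \<le> - (1/2)" if "t \<in> {s+h<..<s+2*h}" for t
        using velocity_ge_half[of "- y t"] yt[of t] mg that by (auto simp: velocity_minus)
      then have "u (s + 2 * h) - u (s + h) \<le> - (1/2) * (s + 2 * h - (s + h))"
        by (intro u_increment_le[OF orb]) (use s sT h_pos in auto)
      then show ?thesis by (simp add: x_def)
    qed
    have late: "y t < 0" if t: "t \<in> {s+2*h..T}" for t
    proof (rule ccontr)
      assume "\<not> y t < 0"
      moreover have "continuous_on {s+2*h..T} y" using cont_y[OF orb] s h_pos by auto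
      moreover have "y (s + 2 * h) < 0" using yt[of "s + 2 * h"] mg h_pos by auto
      ultimately obtain t1 where t1: "s + 2 * h < t1" "t1 \<le> t" "y t1 = 0" "\<And>r. r \<in> {s+2*h..<t1} \<Longrightarrow> y r < 0"
        using first_zero[of "s+2*h" T y t] t by (metis not_less)
      have ur: "u r \<le> x - h/2" if "r \<in> {s+2*h..t1}" for r
      proof -
        have "u r \<le> u (s + 2 * h)"
          by (rule u_nonincreasing[OF orb]) (use that t1 t s h_pos in \<open>auto simp: less_imp_le\<close>)
        then show ?thesis using u2 by simp
      qed
      have "\<bar>y t1 - y (s + 2 * h)\<bar> \<le> A * g (x - h/2) * (t1 - (s + 2 * h))"
        by (rule y_increment_abs[OF orb]) (use t1 t s h_pos ur in auto)
      also have "\<dots> \<le> A * g (x - h/2) * T"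
        using A_pos g_nonneg t1 t s h_pos by (intro mult_left_mono) auto
      finally have "y t1 \<le> - (m * g x) + A * T * g (x - h/2)"
        using yt[of "s + 2 * h"] h_pos by (simp add: algebra_simps)
      moreover have "2 * (A * T * g (x - h/2)) < m * g (x - h/2 + h/2)"
        using x h_pos h_le by (intro X_growth) auto
      moreover have "A * T * g (x - h/2) \<ge> 0" using A_pos T_pos g_nonneg by auto
      ultimately show False using t1(3) by simp
    qed
    have all: "y t \<le> 0" if "t \<in> {s..T}" for t
      using early[of t] late[of t] that sT by (cases "t \<le> s + 2 * h") auto
    have "u T \<le> u (s + 2 * h)"
      by (rule u_nonincreasing[OF orb]) (use all s sT h_pos in auto)
    then show ?thesis using u2 xs all by auto
  qed
  show "y t \<le> 0" if "t \<in> {s..T}" for t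
    using main early[of t] that by (cases "s + 2 * h \<le> T") auto
  show "u T \<le> u s - h/2" if "s + 2 * h \<le> T"
    using main that by auto
qed

text \<open>
  Just before the momentum vanishes for the first time, \<open>a\<close> takes positive values. If the window before
  \<open>t0\<close> is free of zeros, \<open>a\<close> is nonnegative on it. Otherwise it contains the only zero in reach, after
  which \<open>a\<close> is nonnegative up to and beyond \<open>t0\<close>. When \<open>t0\<close> is too close to the starting time for a
  full window, positivity of \<open>a\<close> near \<open>0\<close> helps.
\<close>
lemma crossing_window:
  assumes orb: "orbit T a g u y"
    and t0: "0 < t0" "t0 < T" "y t0 = 0" "\<And>s. s \<in> {0..<t0} \<Longrightarrow> y s > 0"
  shows "(\<forall>t\<in>{t0..min T (t0 + 2 * h)}. a t \<ge> 0) \<or> 2 * h < t0 \<and> (\<forall>t\<in>{t0 - 2 * h..t0}. a t \<ge> 0)"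
proof (cases "t0 \<le> 2 * h")
  case True
  have "a t \<ge> 0" if "t \<in> {t0..min T (t0 + 2 * h)}" for t
    using a_init[of t] that True t0 by auto
  then show ?thesis by blast
next
  case False
  have pos: "\<exists>x\<in>{s<..<t0}. a x > 0" if "0 \<le> s" "s < t0" for s
  proof -
    have "\<exists>x\<in>{s<..<t0}. y t0 - y s = (*) (- (a x * g (u x))) (t0 - s)"
    proof (rule mvt_simple)
      show "(y has_derivative (*) (- (a x * g (u x)))) (at x within {s..t0})" if "s \<le> x" "x \<le> t0" for x
        by (rule DERIV_y[OF orb, unfolded has_field_derivative_def]) (use that \<open>0 \<le> s\<close> t0 in auto)
    qed (use that in auto)
    then obtain x where x: "x \<in> {s<..<t0}" "y t0 - y s = - (a x * g (u x)) * (t0 - s)" by blast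
    have "y s > 0" using t0 that by auto
    then have "a x * g (u x) * (t0 - s) > 0" using x(2) t0(3) by simp
    then have "a x > 0"
      using g_nonneg[of "u x"] that by (auto simp: zero_less_mult_iff)
    then show ?thesis using x by blast
  qed
  show ?thesis
  proof (cases "\<exists>z\<in>{t0 - 2 * h<..<t0}. a z = 0")
    case True
    then obtain z where z: "z \<in> {t0 - 2 * h<..<t0}" "a z = 0" by blast
    obtain x where x: "x \<in> {z<..<t0}" "a x > 0" using pos[of z] z False by auto
    have "a t \<ge> 0" if t: "t \<in> {t0..min T (t0 + 2 * h)}" for t
    proof (rule nonneg_between[of x z "min T (t0 + 2 * h)"])
      show "a r \<noteq> 0" if "r \<in> {z<..<min T (t0 + 2 * h)}" for r
        using gap[of z r] that z False t0 by auto
    qed (use x t z t0 in auto)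
    then show ?thesis by blast
  next
    case no: False
    obtain x where x: "x \<in> {t0 - 2 * h<..<t0}" "a x > 0" using pos[of "t0 - 2 * h"] False h_pos by auto
    have "a t \<ge> 0" if "t \<in> {t0 - 2 * h..t0}" for t
      by (rule nonneg_between[of x "t0 - 2 * h" t0]) (use x no that in auto)
    then show ?thesis using False by auto
  qed
qed

text \<open>
  If \<open>y T \<ge> y 0\<close>, the orbit must start upwards, since otherwise it would keep falling. Let \<open>t0\<close> be
  the first and \<open>t1\<close> the last zero of the momentum. A nonnegative stretch of \<open>a\<close> after \<open>t0\<close> would again make the
  orbit fall for good, so there is one before \<open>t0\<close>. Reading that stretch backwards from \<open>y t0 = 0\<close>, the
  momentum \<open>2 h\<close> before \<open>t0\<close> was at least \<open>m g(x + h/2)\<close>, with \<open>x\<close> the height at that time, and hence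
  \<open>y 0 > A T g(x)\<close>. After \<open>t1\<close> the orbit climbs to \<open>u T = u 0 \<le> x\<close>, so \<open>y T \<le> A T g(x)\<close>.
\<close>
lemma large_closed_orbit_loses_momentum:
  assumes orb: "orbit T a g u y" and u0: "u 0 = X + 2 * T" and uT: "u T = u 0"
  shows "y T < y 0"
proof (rule ccontr)
  assume "\<not> y T < y 0"
  then have yT0: "y 0 \<le> y T" by simp
  define R where "R = X + 2 * T"
  have y0: "y 0 > 0"
  proof (rule ccontr)
    assume "\<not> y 0 > 0"
    moreover have "a t \<ge> 0" if "t \<in> {0..min T (0 + 2 * h)}" for t
      using a_init[of t] that by auto
    ultimately have "u T \<le> u 0 - h/2"
      using large_orbit_keeps_falling(2)[OF orb, of 0] T_pos u0 h_pos h_le by auto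
    then show False using uT h_pos by simp
  qed
  have nodecl: False if "0 \<le> s" "s < T" "u s \<ge> R" "y s = 0" "\<forall>t\<in>{s..min T (s + 2 * h)}. a t \<ge> 0" for s
    using large_orbit_keeps_falling(1)[OF orb that(1,2), of T] that yT0 y0 by (auto simp: R_def)
  obtain z where z: "z \<in> {0<..<T}" "u T - u 0 = velocity (y z) * (T - 0)"
    using u_mean_value[OF orb, of 0 T] T_pos by auto
  have yz: "y z = 0" using z uT T_pos velocity_sgn(3) by auto
  have cy: "continuous_on {0..T} y" using cont_y[OF orb] by simp
  obtain t0 where t0: "0 < t0" "t0 \<le> z" "y t0 = 0" "\<And>s. s \<in> {0..<t0} \<Longrightarrow> y s > 0"
    using first_zero[of 0 T "\<lambda>t. - y t" z] y0 yz z cy by (auto simp: continuous_on_minus)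
  obtain t1 where t1: "0 \<le> t1" "t1 < T" "y t1 = 0" "\<And>s. s \<in> {t1<..T} \<Longrightarrow> y s > 0"
  proof -
    have c: "continuous_on {0..T} (\<lambda>t. - y (T - t))"
      by (intro continuous_intros continuous_on_compose2[OF cy]) auto
    obtain r where r: "0 < r" "r \<le> T - z" "- y (T - r) = 0" "\<And>s. s \<in> {0..<r} \<Longrightarrow> - y (T - s) < 0"
      using first_zero[OF c, of "T - z"] y0 yT0 yz z by auto
    show thesis
    proof (rule that[of "T - r"])
      show "y s > 0" if "s \<in> {T - r<..T}" for s using r(4)[of "T - s"] that by auto
    qed (use r z in auto)
  qed
  have uR: "u s \<ge> R" if "s \<in> {0..t0}" for s
  proof -
    have "u 0 \<le> u s"
      by (rule u_nondecreasing[OF orb]) (use that t0 z in \<open>auto simp: less_imp_le\<close>)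
    then show ?thesis using u0 by (simp add: R_def)
  qed
  have win: "2 * h < t0" "\<And>t. t \<in> {t0 - 2 * h..t0} \<Longrightarrow> a t \<ge> 0"
    using crossing_window[OF orb, of t0] t0 z nodecl[of t0] uR[of t0] by auto
  define x where "x = u (t0 - 2 * h)"
  have x: "x \<ge> R" unfolding x_def using uR win h_pos by auto
  have t0T: "t0 < T" using t0 z by auto
  have RX: "R \<ge> X" using T_pos by (simp add: R_def)
  have mono: "u s \<le> u t" if "0 \<le> s" "s \<le> t" "t \<le> t0" for s t
    by (rule u_nondecreasing[OF orb]) (use that t0 t0T in \<open>auto simp: less_imp_le\<close>)
  have fall: "m * g (u (t0 - h)) \<le> y (t0 - h)"
  proof -
    have "y (t0 - h + h) \<le> y (t0 - h) - m * g (u (t0 - h))"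
      by (rule momentum_drop[OF orb]) (use win t0T h_pos mono in auto)
    then show ?thesis using t0(3) by simp
  qed
  have ydec: "y (t0 - h) \<le> y t" if "t \<in> {t0 - 2 * h..t0 - h}" for t
    by (rule y_nonincreasing[OF orb]) (use that win t0T h_pos in auto)
  have "1 \<le> m * g (u (t0 - h))"
    using uR[of "t0 - h"] win h_pos RX by (intro X_slope) auto
  then have "velocity (y t) \<ge> 1/2" if "t \<in> {t0 - 2 * h<..<t0 - h}" for t
    using ydec[of t] fall that by (intro velocity_ge_half) auto
  then have "1/2 * (t0 - h - (t0 - 2 * h)) \<le> u (t0 - h) - u (t0 - 2 * h)"
    by (intro u_increment_ge[OF orb]) (use win t0T h_pos in auto)
  then have rise: "x + h/2 \<le> u (t0 - h)" by (simp add: x_def)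
  have "m * g (x + h/2) \<le> m * g (u (t0 - h))"
    using g_le[OF rise] m_pos by (intro mult_left_mono) auto
  then have ylarge: "m * g (x + h/2) \<le> y (t0 - 2 * h)"
    using fall ydec[of "t0 - 2 * h"] h_pos by auto
  have "\<bar>y (t0 - 2 * h) - y 0\<bar> \<le> A * g x * (t0 - 2 * h - 0)"
    by (rule y_increment_abs[OF orb]) (use win t0T h_pos mono in \<open>auto simp: x_def\<close>)
  also have "\<dots> \<le> A * g x * T"
    using A_pos g_nonneg t0T h_pos by (intro mult_left_mono) auto
  finally have "y 0 \<ge> m * g (x + h/2) - A * T * g x"
    using ylarge by (simp add: algebra_simps)
  moreover have "2 * (A * T * g x) < m * g (x + h/2)"
    using x RX by (intro X_growth) auto
  ultimately have "y 0 > A * T * g x" by simp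
  moreover have "A * T * g R \<le> A * T * g x"
    using g_le[OF x] A_pos T_pos by (intro mult_left_mono) auto
  moreover have "y T \<le> A * T * g R"
  proof -
    have ule: "u s \<le> R" if "s \<in> {t1..T}" for s
    proof -
      have "u s \<le> u T"
        by (rule u_nondecreasing[OF orb]) (use that t1 in \<open>auto simp: less_imp_le\<close>)
      then show ?thesis using uT u0 by (simp add: R_def)
    qed
    have "\<bar>y T - y t1\<bar> \<le> A * g R * (T - t1)"
      by (rule y_increment_abs[OF orb]) (use t1 ule in auto)
    also have "\<dots> \<le> A * g R * T"
      using A_pos g_nonneg t1 by (intro mult_left_mono) auto
    finally show ?thesis using t1(3) by (simp add: algebra_simps)
  qed
  ultimately show False using yT0 by simp
qed

end

end

section \<open>Small orbits and a nontrivial closed orbit\<close>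

context indefinite_problem
begin

lemma u_increment_abs:
  assumes orb: "orbit T a g u y" and st: "s \<in> {0..T}" "t \<in> {0..T}"
    and y: "\<And>x. x \<in> {0..T} \<Longrightarrow> \<bar>y x\<bar> \<le> c"
  shows "\<bar>u t - u s\<bar> \<le> c * \<bar>t - s\<bar>"
proof -
  have *: "\<bar>u t - u s\<bar> \<le> c * (t - s)" if "0 \<le> s" "s \<le> t" "t \<le> T" for s t
  proof -
    have p: "\<bar>velocity (y x)\<bar> \<le> c" if "x \<in> {0..T}" for x
      using velocity_abs_le[of "y x"] y[OF that] by simp
    have "u t - u s \<le> c * (t - s)"
      by (rule u_increment_le[OF orb that]) (use p that in \<open>auto simp: abs_le_iff\<close>)
    moreover have "- c * (t - s) \<le> u t - u s"
    proof (rule u_increment_ge[OF orb that])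
      show "- c \<le> velocity (y x)" if "x \<in> {s<..<t}" for x
        using p[of x] that \<open>0 \<le> s\<close> \<open>t \<le> T\<close> by auto
    qed
    ultimately show ?thesis by (simp add: abs_le_iff)
  qed
  show ?thesis using *[of s t] *[of t s] st by (cases "s \<le> t") (auto simp: abs_minus_commute)
qed

text \<open>
  Let \<open>G = g(\<mu>)\<close>, with \<open>\<mu>\<close> the maximum of \<open>u\<close>. The momentum vanishes somewhere because \<open>u T = u 0\<close>,
  so it is bounded by \<open>A G T\<close>. Therefore \<open>u\<close> stays within \<open>A G T\<^sup>2\<close> of \<open>\<mu>\<close>, and \<open>g(u)\<close> within
  \<open>e A G T\<^sup>2\<close> of \<open>G\<close>. Replacing \<open>g(u)\<close> by \<open>G\<close> in \<open>y'\<close> thus changes \<open>y T - y 0\<close> by at most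
  \<open>e A\<^sup>2 G T\<^sup>3\<close>, while the constant \<open>G\<close> contributes \<open>- G\<close> times the integral of \<open>a\<close>.
\<close>
lemma small_closed_orbit_gains_momentum:
  assumes orb: "orbit T a g u y" and uT: "u T = u 0"
    and e: "0 < e" "A * A * T * T * T * e \<le> - mass T"
    and lip: "e-lipschitz_on {..\<rho>} g"
    and u_le: "\<And>t. t \<in> {0..T} \<Longrightarrow> u t \<le> \<rho>"
  shows "y 0 \<le> y T"
proof -
  have "\<exists>x\<in>{0..T}. \<forall>t\<in>{0..T}. u t \<le> u x"
    by (rule continuous_attains_sup) (use T_pos cont_u[OF orb] in auto)
  then obtain tm where tm: "tm \<in> {0..T}" "\<And>t. t \<in> {0..T} \<Longrightarrow> u t \<le> u tm" by blast
  define G where "G = g (u tm)"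
  have G: "G \<ge> 0" using g_nonneg by (simp add: G_def)
  obtain z where z: "z \<in> {0<..<T}" "u T - u 0 = velocity (y z) * (T - 0)"
    using u_mean_value[OF orb, of 0 T] T_pos by auto
  have yz: "y z = 0" using z uT T_pos velocity_sgn(3) by auto
  have y_le: "\<bar>y t\<bar> \<le> A * G * T" if t: "t \<in> {0..T}" for t
  proof -
    have "\<bar>y t\<bar> \<le> A * G * \<bar>t - z\<bar>"
    proof (cases "z \<le> t")
      case True
      have "\<bar>y t - y z\<bar> \<le> A * g (u tm) * (t - z)"
        by (rule y_increment_abs[OF orb]) (use True t z tm in auto)
      then show ?thesis using True yz by (simp add: G_def)
    next
      case False
      have "\<bar>y z - y t\<bar> \<le> A * g (u tm) * (z - t)"
        by (rule y_increment_abs[OF orb]) (use False t z tm in auto)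
      then show ?thesis using False yz by (simp add: G_def)
    qed
    also have "\<dots> \<le> A * G * T"
      using A_pos G t z by (intro mult_left_mono) auto
    finally show ?thesis .
  qed
  have near: "\<bar>g (u t) - G\<bar> \<le> e * (A * G * T * T)" if t: "t \<in> {0..T}" for t
  proof -
    have "\<bar>g (u t) - G\<bar> \<le> e * \<bar>u t - u tm\<bar>"
      using lipschitz_onD[OF lip, of "u t" "u tm"] u_le t tm(1) by (auto simp: G_def dist_real_def)
    also have "\<dots> \<le> e * (A * G * T * \<bar>t - tm\<bar>)"
      using e by (intro mult_left_mono u_increment_abs[OF orb] y_le t tm) auto
    also have "\<dots> \<le> e * (A * G * T * T)"
      using e A_pos G T_pos t tm by (intro mult_left_mono) auto
    finally show ?thesis .
  qed
  have "(- y T - G * mass T) - (- y 0 - G * mass 0) \<le> (A * (e * (A * G * T * T))) * (T - 0)"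
  proof (rule increment_le[of 0 T "\<lambda>t. - y t - G * mass t" "\<lambda>t. - (- (a t * g (u t))) - G * a t"])
    show "((\<lambda>t. - y t - G * mass t) has_real_derivative - (- (a t * g (u t))) - G * a t) (at t within {0..T})"
      if "t \<in> {0..T}" for t
      by (intro DERIV_diff DERIV_minus DERIV_cmult DERIV_y[OF orb] DERIV_mass) (use that in auto)
    show "- (- (a t * g (u t))) - G * a t \<le> A * (e * (A * G * T * T))" if "t \<in> {0<..<T}" for t
    proof -
      have "- (- (a t * g (u t))) - G * a t = a t * (g (u t) - G)" by (simp add: algebra_simps)
      also have "\<dots> \<le> \<bar>a t\<bar> * \<bar>g (u t) - G\<bar>" by (simp flip: abs_mult)
      also have "\<dots> \<le> A * (e * (A * G * T * T))"
        using that A_pos by (intro mult_mono near a_le_A) auto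
      finally show ?thesis .
    qed
  qed (use T_pos in auto)
  moreover have "mass 0 = 0" by (simp add: mass_def)
  moreover have "G * (A * A * T * T * T * e) \<le> G * (- mass T)"
    using e G by (intro mult_left_mono) auto
  ultimately show ?thesis by (simp add: algebra_simps)
qed

text \<open>
  It remains to see that an orbit with small initial data stays below \<open>\<rho>\<close> all the time, so that the
  small Lipschitz constant is available. At a first exit time the velocity so far would be bounded by
  a small initial momentum plus \<open>A e \<rho> T\<close>, too little to climb from \<open>\<rho>/8\<close> to \<open>\<rho>\<close>.
\<close>
lemma gain_near_origin:
  obtains r d where "r > 0" "d > 0"
    "\<And>u y. orbit T a g u y \<Longrightarrow> u 0 \<le> r \<Longrightarrow> \<bar>y 0\<bar> \<le> d \<Longrightarrow> u T = u 0 \<Longrightarrow> y 0 \<le> y T"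
proof -
  \<comment> \<open>The first bound serves the exit-time argument, the second is what the gain of momentum requires.\<close>
  define e where "e = min (1 / (2 * A * T * T)) (- mass T / (A * A * T * T * T))"
  have AT: "A * T * T > 0" "A * A * T * T * T > 0" using A_pos T_pos by auto
  have mass: "mass T < 0" using a_mean by (simp add: mass_def)
  have e: "e > 0"
    using A_pos T_pos divide_pos_pos[OF _ AT(2), of "- mass T"] mass by (simp add: e_def)
  have e1: "A * T * T * e \<le> 1/2"
  proof -
    have "A * T * T * e \<le> A * T * T * (1 / (2 * A * T * T))"
      using AT by (intro mult_left_mono) (auto simp: e_def)
    then show ?thesis using A_pos T_pos by (simp add: field_simps)
  qed
  have e2: "A * A * T * T * T * e \<le> - mass T"
  proof -
    have "A * A * T * T * T * e \<le> A * A * T * T * T * (- mass T / (A * A * T * T * T))"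
      using AT by (intro mult_left_mono) (auto simp: e_def)
    then show ?thesis using A_pos T_pos by simp
  qed
  obtain \<rho> where \<rho>: "\<rho> > 0" "e-lipschitz_on {..\<rho>} g" using g_small[OF e] by blast
  have g\<rho>: "g \<rho> \<le> e * \<rho>"
    using lipschitz_onD[OF \<rho>(2), of \<rho> 0] \<rho>(1) g_nonpos[of 0] by (auto simp: dist_real_def)
  show thesis
  proof (rule that[of "\<rho>/8" "\<rho>/(8*T)"])
    show "\<rho>/8 > 0" "\<rho>/(8*T) > 0" using \<rho> T_pos by auto
    fix u y assume orb: "orbit T a g u y" and u0: "u 0 \<le> \<rho>/8" and y0: "\<bar>y 0\<bar> \<le> \<rho>/(8*T)" and uT: "u T = u 0"
    show "y 0 \<le> y T"
    proof (rule small_closed_orbit_gains_momentum[OF orb uT e e2 \<rho>(2)])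
      show "u t \<le> \<rho>" if t: "t \<in> {0..T}" for t
      proof (rule ccontr)
        assume "\<not> u t \<le> \<rho>"
        moreover have "continuous_on {0..T} (\<lambda>t. u t - \<rho>)"
          by (intro continuous_intros cont_u[OF orb]) simp
        moreover have "u 0 - \<rho> < 0" using u0 \<rho> by simp
        moreover have "u t - \<rho> \<ge> 0" using calculation(1) by simp
        ultimately obtain t1 where t1: "0 < t1" "t1 \<le> t" "u t1 - \<rho> = 0"
            "\<And>s. s \<in> {0..<t1} \<Longrightarrow> u s - \<rho> < 0"
          using first_zero[of 0 T "\<lambda>t. u t - \<rho>" t, OF _ _ t] by blast
        have u_le: "u s \<le> \<rho>" if "s \<in> {0..t1}" for s
          using t1(3) t1(4)[of s] that by (cases "s = t1") auto
        define c where "c = \<rho>/(8*T) + A * (e * \<rho>) * T"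
        have c: "c \<ge> 0" using \<rho> e A_pos T_pos by (simp add: c_def)
        have "y s \<le> c" if "s \<in> {0<..<t1}" for s
        proof -
          have "\<bar>y s - y 0\<bar> \<le> A * g \<rho> * (s - 0)"
            by (rule y_increment_abs[OF orb]) (use that t1 t u_le in auto)
          also have "\<dots> \<le> A * (e * \<rho>) * T"
            using g\<rho> A_pos g_nonneg that t1 t e \<rho> by (intro mult_mono) auto
          finally show ?thesis using y0 by (simp add: c_def)
        qed
        then have "velocity (y s) \<le> c" if "s \<in> {0<..<t1}" for s
          using that c by (intro velocity_le) auto
        then have "u t1 - u 0 \<le> c * (t1 - 0)"
          by (intro u_increment_le[OF orb]) (use t1 t in auto)
        also have "\<dots> \<le> c * T" using c t1 t by (intro mult_left_mono) auto
        also have "\<dots> = \<rho>/8 + (A * T * T * e) * \<rho>" using T_pos by (simp add: c_def field_simps)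
        also have "\<dots> \<le> \<rho>/8 + 1/2 * \<rho>" using e1 \<rho> by (intro add_left_mono mult_right_mono) auto
        finally show False using t1(3) u0 \<rho> by simp
      qed
    qed
  qed
qed

text \<open>
  Since \<open>u' \<le> 1\<close>, orbits of the truncated system that start below \<open>K - T\<close> never notice the truncation.
\<close>
lemma orbit_bounded_truncation:
  assumes orb: "orbit T a (\<lambda>x. g (min x K)) u y" and K: "u 0 + T \<le> K"
  shows "orbit T a g u y" "\<And>t. t \<in> {0..T} \<Longrightarrow> u t \<le> K"
proof -
  show le: "u t \<le> K" if t: "t \<in> {0..T}" for t
  proof -
    have "u t - u 0 \<le> 1 * (t - 0)"
    proof (rule increment_le[of 0 t u "\<lambda>t. velocity (y t)"])
      show "(u has_real_derivative velocity (y x)) (at x within {0..t})" if "x \<in> {0..t}" for x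
      proof (rule has_field_derivative_subset)
        show "(u has_real_derivative velocity (y x)) (at x within {0..T})"
          using orb that t by (auto simp: orbit_def)
      qed (use t in auto)
      show "velocity (y x) \<le> 1" for x using velocity_abs_less_1[of "y x"] by auto
    qed (use t in auto)
    then show ?thesis using t K by auto
  qed
  show "orbit T a g u y"
    using orb le by (auto simp: orbit_def min_absorb1)
qed

lemma truncated_flow:
  obtains U Y :: "real \<times> real \<Rightarrow> real \<Rightarrow> real" where
    "\<And>x. orbit T a (\<lambda>x. g (min x K)) (U x) (Y x)" "\<And>x. U x 0 = fst x" "\<And>x. Y x 0 = snd x"
    "continuous_on UNIV (\<lambda>x. U x T)" "continuous_on UNIV (\<lambda>x. Y x T)"
proof -
  define f where "f t = (\<lambda>(u, y). (velocity y, - (a t * g (min u K))))" for t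
  obtain L where L: "L-lipschitz_on {..K} g" using g_lipschitz by blast
  have L0: "L \<ge> 0" using L by (rule lipschitz_on_nonneg)
  have gK: "\<bar>g (min u K) - g (min v K)\<bar> \<le> L * \<bar>u - v\<bar>" for u v
  proof -
    have "\<bar>g (min u K) - g (min v K)\<bar> \<le> L * \<bar>min u K - min v K\<bar>"
      using lipschitz_onD[OF L, of "min u K" "min v K"] by (simp add: dist_real_def)
    also have "\<dots> \<le> L * \<bar>u - v\<bar>" using L0 by (intro mult_left_mono) auto
    finally show ?thesis .
  qed
  have gc: "continuous_on UNIV (\<lambda>u. g (min u K))"
    by (rule lipschitz_on_continuous_on[of L]) (use gK L0 in \<open>auto simp: lipschitz_on_def dist_real_def\<close>)
  have "continuous_on ({0..T} \<times> UNIV) (\<lambda>(t, x). f t x)"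
    unfolding f_def case_prod_unfold
    by (intro continuous_intros continuous_on_compose2[OF a_cont] continuous_on_compose2[OF gc]) auto
  moreover have "norm (f t x - f t x') \<le> (1 + A * L) * norm (x - x')" if t: "t \<in> {0..T}" for t x x'
  proof -
    obtain u y u' y' where x: "x = (u, y)" "x' = (u', y')" by (metis surj_pair)
    have n: "\<bar>u - u'\<bar> \<le> norm (x - x')" "\<bar>y - y'\<bar> \<le> norm (x - x')"
      using norm_fst_le[of "u - u'" "y - y'"] norm_snd_le[of "y - y'" "u - u'"] by (auto simp: x)
    have "norm (f t x - f t x') \<le> \<bar>velocity y - velocity y'\<bar> + \<bar>a t * g (min u' K) - a t * g (min u K)\<bar>"
      using norm_Pair_le[of "velocity y - velocity y'" "a t * g (min u' K) - a t * g (min u K)"]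
      by (simp add: f_def x)
    also have "\<bar>a t * g (min u' K) - a t * g (min u K)\<bar> = \<bar>a t\<bar> * \<bar>g (min u' K) - g (min u K)\<bar>"
      by (simp flip: abs_mult right_diff_distrib)
    also have "\<bar>velocity y - velocity y'\<bar> + \<dots> \<le> norm (x - x') + A * (L * norm (x - x'))"
    proof (intro add_mono mult_mono)
      show "\<bar>velocity y - velocity y'\<bar> \<le> norm (x - x')" using velocity_lipschitz[of y y'] n by simp
      show "\<bar>a t\<bar> \<le> A" using t by (rule a_le_A)
      have "L * \<bar>u' - u\<bar> \<le> L * norm (x - x')"
        using n L0 by (intro mult_left_mono) (auto simp: abs_minus_commute)
      then show "\<bar>g (min u' K) - g (min u K)\<bar> \<le> L * norm (x - x')" using gK[of u' u] by simp
    qed (use A_pos in auto)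
    finally show ?thesis by (simp add: algebra_simps)
  qed
  ultimately obtain X where X: "\<And>x. X x 0 = x"
    "\<And>x t. t \<in> {0..T} \<Longrightarrow> (X x has_vector_derivative f t (X x t)) (at t within {0..T})"
    "continuous_on UNIV (\<lambda>x. X x T)"
    using lipschitz_flow[of T f "1 + A * L"] T_pos by (metis less_imp_le)
  show thesis
  proof (rule that[of "\<lambda>x t. fst (X x t)" "\<lambda>x t. snd (X x t)"])
    show "orbit T a (\<lambda>x. g (min x K)) (\<lambda>t. fst (X x t)) (\<lambda>t. snd (X x t))" for x
      unfolding orbit_def
    proof (intro ballI conjI)
      fix t assume "t \<in> {0..T}"
      from X(2)[OF this, of x] show "((\<lambda>t. fst (X x t)) has_real_derivative velocity (snd (X x t))) (at t within {0..T})"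
        using bounded_linear.has_vector_derivative[OF bounded_linear_fst]
        by (fastforce simp: has_real_derivative_iff_has_vector_derivative f_def case_prod_unfold)
    next
      fix t assume "t \<in> {0..T}"
      from X(2)[OF this, of x]
      show "((\<lambda>t. snd (X x t)) has_real_derivative - (a t * g (min (fst (X x t)) K))) (at t within {0..T})"
        using bounded_linear.has_vector_derivative[OF bounded_linear_snd]
        by (fastforce simp: has_real_derivative_iff_has_vector_derivative f_def case_prod_unfold)
    qed
  qed (auto simp: X(1) intro!: continuous_intros X(3))
qed

text \<open>
  The weight \<open>w\<close> added to \<open>F2\<close> is positive exactly for \<open>x < min r R\<close> and \<open>\<bar>z\<bar> < d\<close>, and this region contains
  every initial point \<open>(x, 0)\<close> with \<open>x \<le> 0\<close>, that is, all trivial solutions.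
\<close>
lemma nontrivial_closed_orbit:
  obtains u y where "orbit T a g u y" "u T = u 0" "y T = y 0" "u 0 > 0 \<or> y 0 \<noteq> 0"
proof -
  obtain h where h: "h > 0" "4 * h \<le> T" "\<And>t. t \<in> {0..4*h} \<Longrightarrow> a t > 0"
    "\<And>z z'. z \<in> {0..T} \<Longrightarrow> z' \<in> {0..T} \<Longrightarrow> a z = 0 \<Longrightarrow> a z' = 0 \<Longrightarrow> \<bar>z - z'\<bar> < 4 * h \<Longrightarrow> z = z'"
    using zero_isolation by blast
  obtain m where m: "m > 0"
    "\<And>s. 0 \<le> s \<Longrightarrow> s + h \<le> T \<Longrightarrow> (\<And>t. t \<in> {s..s+h} \<Longrightarrow> a t \<ge> 0) \<Longrightarrow> m \<le> mass (s + h) - mass s"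
    using uniform_positive_mass[OF h(1)] by blast
  obtain X where X: "X > 0" "\<And>x. x \<ge> X \<Longrightarrow> m * g x \<ge> 1"
    "\<And>x. x \<ge> X \<Longrightarrow> 2 * (A * T * g x) < m * g (x + h/2)"
    using growth_threshold[of "h/2" m] h(1) m(1) by auto
  obtain r d where rd: "r > 0" "d > 0"
    "\<And>u y. orbit T a g u y \<Longrightarrow> u 0 \<le> r \<Longrightarrow> \<bar>y 0\<bar> \<le> d \<Longrightarrow> u T = u 0 \<Longrightarrow> y 0 \<le> y T"
    using gain_near_origin by blast
  define R where "R = X + 2 * T"
  define K where "K = R + T"
  \<comment> \<open>Orbits that start at \<open>x \<le> R\<close> change their momentum by less than \<open>M\<close>.\<close>
  define M where "M = A * g K * T + 1"
  have M: "M > 0" using A_pos g_nonneg[of K] T_pos by (simp add: M_def add_nonneg_pos)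
  have R: "R > 0" using X T_pos by (simp add: R_def)
  obtain U Y where UY: "\<And>x. orbit T a (\<lambda>x. g (min x K)) (U x) (Y x)" "\<And>x. U x 0 = fst x" "\<And>x. Y x 0 = snd x"
    "continuous_on UNIV (\<lambda>x. U x T)" "continuous_on UNIV (\<lambda>x. Y x T)"
    using truncated_flow[of K] by blast
  define w where "w x z = max 0 (min r R - x) * max 0 (d - \<bar>z\<bar>)" for x z :: real
  have w0: "w x z \<ge> 0" for x z by (simp add: w_def)
  define F1 where "F1 x z = U (x, z) T - x" for x z
  define F2 where "F2 x z = Y (x, z) T - z + w x z" for x z
  have orb: "orbit T a g (U (x, z)) (Y (x, z))"
    and U_le: "\<And>t. t \<in> {0..T} \<Longrightarrow> U (x, z) t \<le> K" if "x \<le> R" for x z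
    using orbit_bounded_truncation[OF UY(1)[of "(x, z)"]] that UY(2) by (auto simp: K_def)
  have Y_close: "\<bar>Y (x, z) t - z\<bar> < M" if "x \<le> R" "t \<in> {0..T}" for x z t
  proof -
    have "\<bar>Y (x, z) t - Y (x, z) 0\<bar> \<le> A * g K * (t - 0)"
      by (rule y_increment_abs[OF orb[OF that(1)]]) (use that U_le in auto)
    also have "\<dots> \<le> A * g K * T" using A_pos g_nonneg that by (intro mult_left_mono) auto
    finally show ?thesis using UY(3) by (simp add: M_def)
  qed
  obtain x z where xz: "x \<in> {-T..R}" "z \<in> {-M..M}" "F1 x z = 0" "F2 x z = 0"
  proof (rule rectangle_zero[of "-T" R "-M" M F1 F2])
    show "continuous_on UNIV (\<lambda>(x, z). F1 x z)" "continuous_on UNIV (\<lambda>(x, z). F2 x z)"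
      unfolding F1_def F2_def w_def case_prod_unfold prod.collapse by (intro continuous_intros UY(4,5))+
    fix x assume x: "x \<in> {-T..R}"
    have "Y (x, -M) t \<le> 0" "Y (x, M) t \<ge> 0" if "t \<in> {0<..<T}" for t
      using Y_close[of x t "-M"] Y_close[of x t M] x that by auto
    then have "U (x, -M) T \<le> U (x, -M) 0" "U (x, M) 0 \<le> U (x, M) T"
      using u_nonincreasing[OF orb[of x "-M"], of 0 T] u_nondecreasing[OF orb[of x M], of 0 T] x T_pos
      by simp_all
    then show "F1 x (-M) \<le> 0" "F1 x M \<ge> 0" by (simp_all add: F1_def UY)
  next
    fix z assume "F1 (-T) z = 0"
    have o: "orbit T a g (U (-T, z)) (Y (-T, z))" using R T_pos by (intro orb) simp
    have "U (-T, z) t \<le> 0" if "t \<in> {0..T}" for t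
      using u_lipschitz[OF o, of 0 t] that UY(2)[of "(-T, z)"] by auto
    then have "\<bar>Y (-T, z) T - Y (-T, z) 0\<bar> \<le> A * g 0 * (T - 0)"
      by (intro y_increment_abs[OF o]) (use T_pos in auto)
    then have "Y (-T, z) T = z" using g_nonpos[of 0] by (simp add: UY)
    then show "F2 (-T) z \<ge> 0" using w0 by (simp add: F2_def)
  next
    fix z assume "F1 R z = 0"
    then have "Y (R, z) T < Y (R, z) 0"
      by (intro large_closed_orbit_loses_momentum[OF h m X orb]) (auto simp: F1_def UY R_def)
    then show "F2 R z \<le> 0" by (simp add: F2_def w_def UY)
  qed (use R T_pos M in auto)
  have o: "orbit T a g (U (x, z)) (Y (x, z))" using xz by (intro orb) simp
  have UT: "U (x, z) T = U (x, z) 0" using xz by (simp add: F1_def UY)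
  have "\<not> (x < min r R \<and> \<bar>z\<bar> < d)"
  proof
    assume *: "x < min r R \<and> \<bar>z\<bar> < d"
    then have "w x z > 0" by (simp add: w_def)
    moreover have "Y (x, z) 0 \<le> Y (x, z) T" using * by (intro rd(3)[OF o _ _ UT]) (auto simp: UY)
    ultimately show False using xz(4) by (simp add: F2_def UY)
  qed
  then have "w x z = 0" and nontriv: "x > 0 \<or> z \<noteq> 0" using rd R by (auto simp: w_def)
  then have "Y (x, z) T = Y (x, z) 0" using xz by (simp add: F2_def UY)
  then show thesis using that[OF o UT] nontriv by (simp add: UY)
qed

end

section \<open>Periodic functions\<close>

lemma real_period_shift:
  fixes T t :: real
  assumes "T > 0"
  obtains n :: int where "t - of_int n * T \<in> {0..<T}"
proof (rule that[of "\<lfloor>t / T\<rfloor>"])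
  have "of_int \<lfloor>t / T\<rfloor> * T \<le> t"
    using assms of_int_floor_le[of "t / T"] by (simp only: pos_le_divide_eq)
  moreover have "t < (of_int \<lfloor>t / T\<rfloor> + 1) * T"
    by (rule pos_divide_less_eq[OF assms, THEN iffD1]) linarith
  ultimately show "t - of_int \<lfloor>t / T\<rfloor> * T \<in> {0..<T}" by (simp add: algebra_simps)
qed

lemma antiderivative_exists:
  fixes f :: "real \<Rightarrow> real"
  assumes "continuous_on UNIV f"
  obtains F where "\<And>t. (F has_real_derivative f t) (at t)"
  using einterval_antiderivative[of "-\<infinity>" "\<infinity>" f] assms
  by (auto simp: continuous_on_eq_continuous_at has_real_derivative_iff_has_vector_derivative)

text \<open>
  The function \<open>\<lambda>t. F (t + T) - F t\<close> has derivative \<open>0\<close>.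
\<close>
lemma periodic_increment_const:
  fixes F f :: "real \<Rightarrow> real"
  assumes F: "\<And>t. (F has_real_derivative f t) (at t)" and f: "periodic_fun_simple f T"
  shows "F (t + T) - F t = F (s + T) - F s"
proof -
  interpret periodic_fun_simple f T by (fact f)
  have "((\<lambda>t. F (t + T) - F t) has_real_derivative 0) (at t)" for t
    using DERIV_diff[OF DERIV_shift[THEN iffD1, OF F[of "t + T"]] F[of t]] by (simp add: plus_1)
  then show ?thesis using DERIV_isconst_all[of "\<lambda>t. F (t + T) - F t" t s] by blast
qed

lemma periodic_extension:
  fixes f :: "real \<Rightarrow> real"
  assumes T: "T > 0" and f: "continuous_on {0..T} f" "f T = f 0"
  obtains F where "continuous_on UNIV F" "periodic_fun_simple F T" "\<And>t. t \<in> {0..T} \<Longrightarrow> F t = f t"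
proof -
  define F where "F t = f (t - of_int \<lfloor>t / T\<rfloor> * T)" for t
  have cell: "F t = f (t - of_int n * T)" if "t \<in> {of_int n * T..of_int (n + 1) * T}" for n t
  proof (cases "t = of_int (n + 1) * T")
    case True
    then have "t / T = of_int (n + 1)" using T by simp
    then have "F t = f 0" unfolding F_def using T by (simp only: floor_of_int) (simp add: True)
    moreover have "t - of_int n * T = T" using True by (simp add: algebra_simps)
    ultimately show ?thesis using f(2) by simp
  next
    case False
    then have "\<lfloor>t / T\<rfloor> = n"
      using that T by (intro floor_unique) (auto simp: field_simps)
    then show ?thesis by (simp add: F_def)
  qed
  have cont_cell: "continuous_on {of_int n * T..of_int (n + 1) * T} F" for n
  proof (rule continuous_on_eq)
    show "continuous_on {of_int n * T..of_int (n + 1) * T} (\<lambda>t. f (t - of_int n * T))"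
      by (intro continuous_on_compose2[OF f(1)] continuous_intros) (auto simp: algebra_simps)
  qed (use cell in auto)
  show thesis
  proof (rule that)
    show "continuous_on UNIV F"
      unfolding continuous_on_eq_continuous_at[OF open_UNIV]
    proof
      fix t :: real
      define n where "n = \<lfloor>t / T\<rfloor>"
      have "of_int n \<le> t / T" "t / T < of_int n + 1" by (auto simp: n_def)
      then have n: "of_int n * T \<le> t" "t < of_int (n + 1) * T" using T by (auto simp: field_simps)
      have "continuous_on ({of_int (n - 1) * T..of_int n * T} \<union> {of_int n * T..of_int (n + 1) * T}) F"
        using cont_cell[of n] cont_cell[of "n - 1"] by (intro continuous_on_closed_Un) auto
      moreover have "{of_int (n - 1) * T<..<of_int (n + 1) * T} \<subseteq>
          {of_int (n - 1) * T..of_int n * T} \<union> {of_int n * T..of_int (n + 1) * T}" by auto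
      ultimately have "continuous_on {of_int (n - 1) * T<..<of_int (n + 1) * T} F"
        by (rule continuous_on_subset)
      moreover have "t \<in> {of_int (n - 1) * T<..<of_int (n + 1) * T}"
        using n T by (auto simp: algebra_simps)
      ultimately show "continuous (at t) F"
        by (simp add: continuous_on_eq_continuous_at)
    qed
    show "periodic_fun_simple F T"
    proof
      fix t
      have "\<lfloor>(t + T) / T\<rfloor> = \<lfloor>t / T\<rfloor> + 1" using T by (simp add: add_divide_distrib)
      then show "F (t + T) = F t" by (simp add: F_def algebra_simps)
    qed
    show "F t = f t" if "t \<in> {0..T}" for t
      using cell[of t 0] that by simp
  qed
qed

text \<open>
  This is how an orbit on \<open>[0, T]\<close> is continued to the real line without gluing derivatives: continue the
  right-hand side continuously, then integrate. The closing condition \<open>v T = v 0\<close> makes the primitive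
  periodic.
\<close>
lemma periodic_primitive:
  fixes f v :: "real \<Rightarrow> real"
  assumes T: "T > 0" and f: "continuous_on UNIV f" "periodic_fun_simple f T"
    and v: "\<And>t. t \<in> {0..T} \<Longrightarrow> (v has_real_derivative f t) (at t within {0..T})" "v T = v 0"
  obtains V where "\<And>t. (V has_real_derivative f t) (at t)" "periodic_fun_simple V T"
    "\<And>t. t \<in> {0..T} \<Longrightarrow> V t = v t"
proof -
  obtain F where F: "\<And>t. (F has_real_derivative f t) (at t)"
    using antiderivative_exists[OF f(1)] by blast
  have "((\<lambda>t. F t - v t) has_real_derivative 0) (at t within {0..T})" if "t \<in> {0..T}" for t
    using DERIV_diff[OF has_field_derivative_at_within[OF F] v(1)[OF that]] by simp
  then obtain c where c: "\<And>t. t \<in> {0..T} \<Longrightarrow> F t - v t = c"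
    using has_field_derivative_zero_constant[of "{0..T}" "\<lambda>t. F t - v t"] by auto
  define V where "V t = F t - c" for t
  have eq: "V t = v t" if "t \<in> {0..T}" for t using c[OF that] by (simp add: V_def)
  show thesis
  proof (rule that)
    show D: "(V has_real_derivative f t) (at t)" for t
      unfolding V_def using F by (auto intro!: derivative_eq_intros)
    show "periodic_fun_simple V T"
    proof
      fix t
      show "V (t + T) = V t"
        using periodic_increment_const[OF D f(2), of t 0] eq[of 0] eq[of T] v(2) T by simp
    qed
  qed (use eq in auto)
qed

lemma periodic_eqI:
  fixes f F :: "real \<Rightarrow> real"
  assumes T: "T > 0" and "periodic_fun_simple f T" "periodic_fun_simple F T"
    and eq: "\<And>t. t \<in> {0..T} \<Longrightarrow> F t = f t"
  shows "F t = f t"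
proof -
  interpret f: periodic_fun_simple f T by fact
  interpret F: periodic_fun_simple F T by fact
  obtain n :: int where "t - of_int n * T \<in> {0..<T}" using real_period_shift[OF T] .
  then show ?thesis using eq[of "t - of_int n * T"] f.minus_of_int[of t n] F.minus_of_int[of t n] by simp
qed

lemma periodic_range:
  fixes f :: "real \<Rightarrow> real"
  assumes T: "T > 0" and "periodic_fun_simple f T"
  obtains s where "s \<in> {0..T}" "f s = f t"
proof -
  interpret f: periodic_fun_simple f T by fact
  obtain n :: int where "t - of_int n * T \<in> {0..<T}" using real_period_shift[OF T] .
  then show ?thesis using that[of "t - of_int n * T"] f.minus_of_int[of t n] by simp
qed

lemma periodic_attains_inf:
  fixes f :: "real \<Rightarrow> real"
  assumes T: "T > 0" and per: "periodic_fun_simple f T" and f: "continuous_on UNIV f"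
  obtains s where "\<And>t. f s \<le> f t"
proof -
  have "\<exists>s\<in>{0..T}. \<forall>t\<in>{0..T}. f s \<le> f t"
    by (rule continuous_attains_inf) (use T in \<open>auto intro: continuous_on_subset[OF f]\<close>)
  then obtain s where s: "\<And>t. t \<in> {0..T} \<Longrightarrow> f s \<le> f t" by blast
  have "f s \<le> f t" for t
    using s periodic_range[OF T per, of t] by metis
  then show thesis by (rule that)
qed

lemma periodic_bounded:
  fixes f :: "real \<Rightarrow> real"
  assumes T: "T > 0" and per: "periodic_fun_simple f T" and f: "continuous_on UNIV f"
  obtains B where "B > 0" "\<And>t. \<bar>f t\<bar> \<le> B"
proof -
  have "periodic_fun_simple (\<lambda>t. - \<bar>f t\<bar>) T"
    using per by (simp add: periodic_fun_simple_def)
  moreover have "continuous_on UNIV (\<lambda>t. - \<bar>f t\<bar>)" by (intro continuous_intros f)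
  ultimately obtain s where s: "\<And>t. - \<bar>f s\<bar> \<le> - \<bar>f t\<bar>"
    using periodic_attains_inf[OF T, of "\<lambda>t. - \<bar>f t\<bar>"] by blast
  have "\<bar>f t\<bar> \<le> \<bar>f s\<bar> + 1" for t using s[of t] by simp
  then show thesis by (intro that[of "\<bar>f s\<bar> + 1"]) auto
qed

text \<open>
  Every zero of the shifted function arises from one in \<open>[0, T[\<close> by a multiple of the period, and only
  finitely many multiples are possible.
\<close>
lemma finite_zeros_shift:
  fixes a :: "real \<Rightarrow> real"
  assumes T: "T > 0" and per: "periodic_fun_simple a T" and fin: "finite {t \<in> {0..<T}. a t = 0}"
  shows "finite {t \<in> {0..T}. a (t + c) = 0}"
proof -
  interpret a: periodic_fun_simple a T by (fact per)
  let ?Z = "{t \<in> {0..<T}. a t = 0}" and ?N = "{\<lfloor>c / T\<rfloor>..\<lfloor>(T + c) / T\<rfloor>}"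
  have "t \<in> (\<lambda>(z, n). z + of_int n * T - c) ` (?Z \<times> ?N)" if t: "t \<in> {0..T}" "a (t + c) = 0" for t
  proof -
    obtain n :: int where n: "t + c - of_int n * T \<in> {0..<T}" using real_period_shift[OF T] .
    have "of_int n \<le> (t + c) / T" "(t + c) / T < of_int n + 1"
      using n T by (auto simp: field_simps)
    then have "n = \<lfloor>(t + c) / T\<rfloor>" by (intro floor_unique[symmetric]) auto
    moreover have "c / T \<le> (t + c) / T" "(t + c) / T \<le> (T + c) / T"
      using t T by (auto intro: divide_right_mono)
    ultimately have "n \<in> ?N" by (auto intro: floor_mono)
    moreover have "t + c - of_int n * T \<in> ?Z" using n t a.minus_of_int[of "t + c" n] by simp
    ultimately show ?thesis by (intro image_eqI[of _ _ "(t + c - of_int n * T, n)"]) auto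
  qed
  then have "{t \<in> {0..T}. a (t + c) = 0} \<subseteq> (\<lambda>(z, n). z + of_int n * T - c) ` (?Z \<times> ?N)" by blast
  then show ?thesis by (rule finite_subset) (use fin in auto)
qed

lemma integral_shift_periodic:
  fixes a :: "real \<Rightarrow> real"
  assumes T: "T > 0" and a: "continuous_on UNIV a" and per: "periodic_fun_simple a T"
  shows "integral {0..T} (\<lambda>t. a (t + c)) = integral {0..T} a"
proof -
  obtain F where F: "\<And>t. (F has_real_derivative a t) (at t)" using antiderivative_exists[OF a] by blast
  have "((\<lambda>t. a (t + c)) has_integral F (T + c) - F (0 + c)) {0..T}"
    using T by (intro fundamental_theorem_of_calculus)
      (auto simp: has_real_derivative_iff_has_vector_derivative[symmetric]
        intro!: has_field_derivative_at_within DERIV_shift[THEN iffD1] F)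
  moreover have "(a has_integral F T - F 0) {0..T}"
    using T by (intro fundamental_theorem_of_calculus)
      (auto simp: has_real_derivative_iff_has_vector_derivative[symmetric]
        intro!: has_field_derivative_at_within F)
  moreover have "F (T + c) - F (0 + c) = F T - F 0"
    using periodic_increment_const[OF F per, of c 0] by (simp add: add.commute)
  ultimately show ?thesis by (metis integral_unique)
qed

section \<open>Positivity of the periodic orbit\<close>

text \<open>
  A uniqueness argument at a rest point that is a minimum of \<open>U\<close>. On a short interval after a time of rest,
  let \<open>D\<close> be the largest height gained. Then \<open>g(U) \<le> L D\<close>, so momentum and velocity are at most \<open>B L D\<close>, and
  the height gained is at most \<open>B L D h \<le> D / 2\<close>. Thus \<open>D = 0\<close>, and the interval length \<open>h\<close> is the same
  for every such step.
\<close>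
lemma rest_persists:
  fixes U Y b :: "real \<Rightarrow> real"
  assumes U: "\<And>t. (U has_real_derivative velocity (Y t)) (at t)"
    and Y: "\<And>t. (Y has_real_derivative - (b t * g (U t))) (at t)"
    and min: "\<And>t. U s \<le> U t" and rest: "Y s = 0" and g0: "g (U s) = 0"
    and bB: "\<And>t. \<bar>b t\<bar> \<le> B" and B: "B > 0"
    and UK: "\<And>t. U t \<le> K" and lip: "L-lipschitz_on {..K} g"
    and "t \<ge> s"
  shows "U t = U s \<and> Y t = 0"
proof -
  have L: "L \<ge> 0" using lip by (rule lipschitz_on_nonneg)
  \<comment> \<open>The summand \<open>1\<close> covers \<open>L = 0\<close> and ensures \<open>h \<le> 1\<close>.\<close>
  define h where "h = 1 / (2 * (B * L + 1))"
  have BL: "B * L \<ge> 0" using B L by simp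
  have h: "h > 0" "h \<le> 1" "B * L * h \<le> 1/2" using BL by (auto simp: h_def field_simps)
  have step: "U t = U s \<and> Y t = 0" if r: "U r = U s" "Y r = 0" and t: "t \<in> {r..r+h}" for r t
  proof -
    have "\<exists>x\<in>{r..r+h}. \<forall>t\<in>{r..r+h}. U t \<le> U x"
      by (rule continuous_attains_sup) (use h in \<open>auto intro: DERIV_continuous_on[OF has_field_derivative_at_within[OF U]]\<close>)
    then obtain x where x: "x \<in> {r..r+h}" "\<And>t. t \<in> {r..r+h} \<Longrightarrow> U t \<le> U x" by blast
    define D where "D = U x - U s"
    have D: "D \<ge> 0" using min by (simp add: D_def)
    have Yb: "\<bar>Y t\<bar> \<le> B * (L * D)" if t: "t \<in> {r..r+h}" for t
    proof -
      have "norm (Y t - Y r) \<le> B * (L * D) * norm (t - r)"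
      proof (rule field_differentiable_bound[of "{r..r+h}" Y "\<lambda>t. - (b t * g (U t))"])
        show "norm (- (b q * g (U q))) \<le> B * (L * D)" if q: "q \<in> {r..r+h}" for q
        proof -
          have "\<bar>g (U q)\<bar> \<le> L * \<bar>U q - U s\<bar>"
            using lipschitz_onD[OF lip, of "U q" "U s"] UK g0 by (simp add: dist_real_def)
          also have "\<dots> \<le> L * D"
            using x(2)[OF q] min[of q] L by (intro mult_left_mono) (auto simp: D_def)
          finally show ?thesis using bB[of q] B by (auto simp: abs_mult intro!: mult_mono)
        qed
      qed (use t h in \<open>auto intro: has_field_derivative_at_within[OF Y]\<close>)
      also have "\<dots> \<le> B * (L * D) * 1"
        using t h B L D by (intro mult_left_mono) auto
      finally show ?thesis using r by simp
    qed
    have "norm (U x - U r) \<le> B * (L * D) * norm (x - r)"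
    proof (rule field_differentiable_bound[of "{r..r+h}" U "\<lambda>t. velocity (Y t)"])
      show "norm (velocity (Y q)) \<le> B * (L * D)" if "q \<in> {r..r+h}" for q
        using velocity_abs_le[of "Y q"] Yb[OF that] by simp
    qed (use x h in \<open>auto intro: has_field_derivative_at_within[OF U]\<close>)
    also have "\<dots> \<le> B * (L * D) * h"
      using x h B L D by (intro mult_left_mono) auto
    also have "\<dots> = (B * L * h) * D" by simp
    also have "\<dots> \<le> 1/2 * D" using h D by (intro mult_right_mono) auto
    finally have "norm (U x - U r) \<le> 1/2 * D" .
    then have "U x - U r \<le> 1/2 * D" by (simp only: real_norm_def abs_le_iff)
    then have "D \<le> 0" using r(1) by (simp add: D_def)
    then have "D = 0" using D by simp
    then show ?thesis using x(2)[OF t] min[of t] Yb[OF t] by (simp add: D_def)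
  qed
  have all: "\<forall>t\<in>{s..s + of_nat n * h}. U t = U s \<and> Y t = 0" for n
  proof (induction n)
    case 0
    then show ?case using rest by simp
  next
    case (Suc n)
    let ?r = "s + of_nat n * h"
    have "?r \<in> {s..?r}" using h by simp
    then have "U ?r = U s" "Y ?r = 0" using Suc by blast+
    then have "U t = U s \<and> Y t = 0" if "t \<in> {?r..?r+h}" for t using step that by blast
    moreover have "t \<in> {s..?r} \<or> t \<in> {?r..?r+h}" if "t \<in> {s..s + of_nat (Suc n) * h}" for t
      using that by (auto simp: algebra_simps)
    ultimately show ?case using Suc by blast
  qed
  obtain n where "(t - s) / h < of_nat n" using reals_Archimedean2 by blast
  then have "t - s \<le> of_nat n * h" using pos_divide_less_eq[OF h(1)] by (simp add: less_imp_le)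
  then have "t \<in> {s..s + of_nat n * h}" using \<open>t \<ge> s\<close> by simp
  then show ?thesis using all by blast
qed

text \<open>
  Continue the closed orbit periodically. If its minimum is nonpositive, it is at rest there and \<open>g\<close> vanishes,
  so it rests for ever; by periodicity it would then be one of the excluded trivial solutions.
\<close>
lemma (in indefinite_problem) positive_periodic_orbit:
  assumes per: "periodic_fun_simple a T"
  obtains U Y where "\<And>t. (U has_real_derivative velocity (Y t)) (at t)"
    "\<And>t. (Y has_real_derivative - (a t * g (U t))) (at t)"
    "periodic_fun_simple U T" "periodic_fun_simple Y T" "\<And>t. U t > 0"
proof -
  obtain u y where uy: "orbit T a g u y" "u T = u 0" "y T = y 0" "u 0 > 0 \<or> y 0 \<noteq> 0"
    by (rule nontrivial_closed_orbit)
  have gc: "continuous_on UNIV g"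
  proof -
    have "isCont g x" for x
    proof -
      obtain L where "L-lipschitz_on {..x + 1} g" using g_lipschitz by blast
      then have "continuous_on {..<x + 1} g"
        by (intro continuous_on_subset[OF lipschitz_on_continuous_on]) auto
      then show ?thesis by (simp add: continuous_on_eq_continuous_at)
    qed
    then show ?thesis by (simp add: continuous_on_eq_continuous_at)
  qed
  obtain Y0 where Y0: "continuous_on UNIV Y0" "periodic_fun_simple Y0 T" "\<And>t. t \<in> {0..T} \<Longrightarrow> Y0 t = y t"
    using periodic_extension[OF T_pos cont_y[OF uy(1)] uy(3)] by auto
  have u_der: "(u has_real_derivative velocity (Y0 t)) (at t within {0..T})" if "t \<in> {0..T}" for t
    using uy(1) that Y0(3)[OF that] by (auto simp: orbit_def)
  have u_per: "periodic_fun_simple (\<lambda>t. velocity (Y0 t)) T"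
    using Y0(2) by (simp add: periodic_fun_simple_def)
  have u_cont: "continuous_on UNIV (\<lambda>t. velocity (Y0 t))" by (intro continuous_intros Y0)
  obtain U where U: "\<And>t. (U has_real_derivative velocity (Y0 t)) (at t)" "periodic_fun_simple U T"
      "\<And>t. t \<in> {0..T} \<Longrightarrow> U t = u t"
    using periodic_primitive[OF T_pos u_cont u_per u_der uy(2)] by blast
  have cU: "continuous_on UNIV U" by (meson U(1) DERIV_isCont continuous_at_imp_continuous_on)
  have y_der: "(y has_real_derivative - (a t * g (U t))) (at t within {0..T})" if "t \<in> {0..T}" for t
    using uy(1) that U(3)[OF that] by (auto simp: orbit_def)
  have y_per: "periodic_fun_simple (\<lambda>t. - (a t * g (U t))) T"
    using U(2) per by (simp add: periodic_fun_simple_def)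
  have y_cont: "continuous_on UNIV (\<lambda>t. - (a t * g (U t)))"
    by (intro continuous_intros a_cont continuous_on_compose2[OF gc cU]) auto
  obtain Y where Y: "\<And>t. (Y has_real_derivative - (a t * g (U t))) (at t)" "periodic_fun_simple Y T"
      "\<And>t. t \<in> {0..T} \<Longrightarrow> Y t = y t"
    using periodic_primitive[OF T_pos y_cont y_per y_der uy(3)] by blast
  have YY0: "Y t = Y0 t" for t
  proof (rule periodic_eqI[OF T_pos Y0(2) Y(2)])
    show "Y t = Y0 t" if "t \<in> {0..T}" for t using Y(3)[OF that] Y0(3)[OF that] by simp
  qed
  have DU: "(U has_real_derivative velocity (Y t)) (at t)" for t using U(1)[of t] by (simp only: YY0)
  obtain s where s: "\<And>t. U s \<le> U t" using periodic_attains_inf[OF T_pos U(2) cU] by blast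
  have "U s > 0"
  proof (rule ccontr)
    assume "\<not> U s > 0"
    then have neg: "U s \<le> 0" by simp
    have "velocity (Y s) = 0" by (rule DERIV_local_min[OF DU, of 1]) (use s in auto)
    then have Ys: "Y s = 0" by (simp add: velocity_sgn)
    obtain B where B: "B > 0" "\<And>t. \<bar>a t\<bar> \<le> B" using periodic_bounded[OF T_pos per a_cont] by blast
    obtain K where K: "\<And>t. \<bar>U t\<bar> \<le> K" using periodic_bounded[OF T_pos U(2) cU] by blast
    obtain L where L: "L-lipschitz_on {..K} g" using g_lipschitz by blast
    have UK: "U t \<le> K" for t using K[of t] by simp
    have rest: "U t = U s \<and> Y t = 0" if "t \<ge> s" for t
      by (rule rest_persists[OF DU Y(1) s Ys g_nonpos[OF neg] B(2,1) UK L that])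
    interpret U: periodic_fun_simple U T by (fact U(2))
    interpret Y: periodic_fun_simple Y T by (fact Y(2))
    obtain n where "s / T < of_nat n" using reals_Archimedean2 by blast
    then have "s \<le> 0 + of_nat n * T" using T_pos by (simp add: field_simps)
    then have "U 0 = U s" "Y 0 = 0" using rest[of "0 + of_nat n * T"] U.plus_of_nat[of 0 n] Y.plus_of_nat[of 0 n] by auto
    then show False using neg uy(4) U(3)[of 0] Y(3)[of 0] T_pos by simp
  qed
  then have "U t > 0" for t using s[of t] by simp
  then show thesis using that DU Y U by blast
qed

section \<open>From orbits to periodic solutions\<close>

lemma bounded_derivative_imp_absolutely_continuous_on:
  fixes f f' :: "real \<Rightarrow> real"
  assumes f: "\<And>t. (f has_real_derivative f' t) (at t)" and B: "\<And>t. \<bar>f' t\<bar> \<le> B"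
  shows "absolutely_continuous_on S f"
  unfolding absolutely_continuous_on_def
proof (intro allI impI)
  fix e :: real assume e: "e > 0"
  have B0: "B \<ge> 0" using B[of 0] by simp
  have lip: "\<bar>f x - f y\<bar> \<le> B * \<bar>x - y\<bar>" for x y
    using field_differentiable_bound[of UNIV f f' B x y] f B by simp
  show "\<exists>d>0. \<forall>\<D>. \<D> division_of \<Union>\<D> \<and> \<Union>\<D> \<subseteq> S \<and> (\<Sum>K\<in>\<D>. Sup K - Inf K) < d \<longrightarrow>
        (\<Sum>K\<in>\<D>. \<bar>f (Sup K) - f (Inf K)\<bar>) < e"
  proof (intro exI[of _ "e / (B + 1)"] conjI allI impI)
    show "e / (B + 1) > 0" using e B0 by simp
    fix \<D> :: "real set set"
    assume *: "\<D> division_of \<Union>\<D> \<and> \<Union>\<D> \<subseteq> S \<and> (\<Sum>K\<in>\<D>. Sup K - Inf K) < e / (B + 1)"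
    have le: "Inf K \<le> Sup K" if K: "K \<in> \<D>" for K
    proof -
      obtain a b where "K = cbox a b" "K \<noteq> {}"
        using division_ofD(3,4)[OF conjunct1[OF *] K] by metis
      then show ?thesis by simp
    qed
    have "(\<Sum>K\<in>\<D>. \<bar>f (Sup K) - f (Inf K)\<bar>) \<le> (\<Sum>K\<in>\<D>. B * (Sup K - Inf K))"
      by (intro sum_mono order_trans[OF lip]) (use le in auto)
    also have "\<dots> = B * (\<Sum>K\<in>\<D>. Sup K - Inf K)" by (simp add: sum_distrib_left)
    also have "\<dots> \<le> B * (e / (B + 1))" using * B0 by (intro mult_left_mono) auto
    also have "\<dots> < e" using e B0 by (simp add: field_simps)
    finally show "(\<Sum>K\<in>\<D>. \<bar>f (Sup K) - f (Inf K)\<bar>) < e" .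
  qed
qed

lemma periodic_solutionI:
  assumes T: "T > 0" and a: "continuous_on UNIV a"
    and gU: "continuous_on UNIV (\<lambda>t. g (U t))"
    and U: "\<And>t. (U has_real_derivative velocity (Y t)) (at t)"
    and Y: "\<And>t. (Y has_real_derivative - (a t * g (U t))) (at t)"
    and per: "periodic_fun_simple a T" "periodic_fun_simple U T"
  shows "periodic_solution T a g U"
proof -
  have dU: "deriv U t = velocity (Y t)" for t using U by (rule DERIV_imp_deriv)
  have \<Phi>: "(\<lambda>t. deriv U t / sqrt (1 - (deriv U t)\<^sup>2)) = Y"
    by (simp add: dU velocity_inverse)
  have cY: "continuous_on UNIV Y" by (meson Y DERIV_isCont continuous_at_imp_continuous_on)
  have "U C1_differentiable_on UNIV"
    unfolding C1_differentiable_on_def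
    by (rule exI[of _ "\<lambda>t. velocity (Y t)"])
      (use U in \<open>auto simp: has_real_derivative_iff_has_vector_derivative intro!: continuous_intros cY\<close>)
  moreover have "continuous_on UNIV (\<lambda>t. - (a t * g (U t)))" by (intro continuous_intros a gU)
  moreover have "periodic_fun_simple (\<lambda>t. - (a t * g (U t))) T"
    using per by (simp add: periodic_fun_simple_def)
  ultimately obtain B where "\<And>t. \<bar>- (a t * g (U t))\<bar> \<le> B"
    using periodic_bounded[OF T] by blast
  then have "absolutely_continuous_on {0..T} Y"
    by (rule bounded_derivative_imp_absolutely_continuous_on[OF Y])
  moreover have "AE t in lebesgue. Y differentiable at t \<and> deriv Y t + a t * g (U t) = 0"
    using Y DERIV_imp_deriv[OF Y] by (auto simp: real_differentiable_def intro!: AE_I2)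
  ultimately show ?thesis
    unfolding periodic_solution_def Let_def \<Phi>
    using \<open>U C1_differentiable_on UNIV\<close> per velocity_abs_less_1 by (simp add: dU)
qed

section \<open>The nonlinearity\<close>

text \<open>
  The continuation of \<open>exp (x powr p) - 1\<close> by \<open>0\<close>.
\<close>
definition exp_power :: "real \<Rightarrow> real \<Rightarrow> real" where
  "exp_power p x = exp (max x 0 powr p) - 1"

text \<open>
  The constant is the derivative at \<open>K\<close>, which is the largest one on \<open>[0, K]\<close>.
\<close>
lemma exp_power_lipschitz:
  assumes p: "p > 1" and K: "K > 0"
  shows "(exp (K powr p) * (p * K powr (p - 1)))-lipschitz_on {..K} (exp_power p)"
proof (rule lipschitz_onI)
  let ?L = "exp (K powr p) * (p * K powr (p - 1))"
  have L: "?L \<ge> 0" using p by simp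
  then show "?L \<ge> 0" .
  have main: "\<bar>exp_power p y - exp_power p x\<bar> \<le> ?L * (y - x)" if xy: "0 \<le> x" "x < y" "y \<le> K" for x y
  proof -
    have e: "exp_power p z = exp (z powr p) - 1" if "0 \<le> z" for z
      using that by (simp add: exp_power_def max_def)
    have "\<exists>z. x < z \<and> z < y \<and> exp (y powr p) - 1 - (exp (x powr p) - 1)
        = (*) (exp (z powr p) * (p * z powr (p - 1))) (y - x)"
    proof (rule mvt[OF xy(2), of "\<lambda>z. exp (z powr p) - 1"])
      show "continuous_on {x..y} (\<lambda>z. exp (z powr p) - 1)"
        by (intro continuous_intros continuous_on_powr') (use xy p in auto)
      show "((\<lambda>z. exp (z powr p) - 1) has_derivative (*) (exp (z powr p) * (p * z powr (p - 1)))) (at z)"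
        if "x < z" for z
        using that xy has_real_derivative_powr[of z p] unfolding has_field_derivative_def[symmetric]
        by (auto intro!: derivative_eq_intros)
    qed blast
    then obtain z where z: "x < z" "z < y"
      "exp (y powr p) - 1 - (exp (x powr p) - 1) = exp (z powr p) * (p * z powr (p - 1)) * (y - x)"
      by blast
    have "exp (z powr p) * (p * z powr (p - 1)) \<le> ?L"
    proof (intro mult_mono)
      show "exp (z powr p) \<le> exp (K powr p)" using z xy p powr_mono2[of p z K] by simp
      show "z powr (p - 1) \<le> K powr (p - 1)" using z xy p by (intro powr_mono2) auto
    qed (use p in auto)
    then have "exp (z powr p) * (p * z powr (p - 1)) * (y - x) \<le> ?L * (y - x)"
      using xy by (intro mult_right_mono) auto
    moreover have "exp (z powr p) * (p * z powr (p - 1)) * (y - x) \<ge> 0" using p xy by simp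
    ultimately show ?thesis using z(3) e[of x] e[of y] xy by simp
  qed
  have main': "\<bar>exp_power p x - exp_power p y\<bar> \<le> ?L * \<bar>x - y\<bar>"
    if "0 \<le> x" "x \<le> K" "0 \<le> y" "y \<le> K" for x y
    using main[of x y] main[of y x] that
    by (cases x y rule: linorder_cases) (auto simp: abs_minus_commute)
  fix x y :: real assume "x \<in> {..K}" "y \<in> {..K}"
  then have le: "max x 0 \<le> K" "max y 0 \<le> K" using K by auto
  have m: "exp_power p z = exp_power p (max z 0)" for z by (simp add: exp_power_def)
  have "\<bar>exp_power p (max x 0) - exp_power p (max y 0)\<bar> \<le> ?L * \<bar>max x 0 - max y 0\<bar>"
    using le by (intro main') auto
  also have "\<dots> \<le> ?L * \<bar>x - y\<bar>" using L by (intro mult_left_mono) auto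
  finally show "dist (exp_power p x) (exp_power p y) \<le> ?L * dist x y"
    using m[of x] m[of y] by (simp add: dist_real_def)
qed

lemma exp_power_small:
  assumes p: "p > 1" and e: "e > 0"
  obtains r where "r > 0" "e-lipschitz_on {..r} (exp_power p)"
proof -
  define r where "r = min 1 ((e / (exp 1 * p)) powr (1 / (p - 1)))"
  have r: "r > 0" "r \<le> 1" using p e by (auto simp: r_def)
  have "exp (r powr p) \<le> exp 1" using r p powr_mono2[of p r 1] by simp
  moreover have "r powr (p - 1) \<le> e / (exp 1 * p)"
  proof -
    have "r powr (p - 1) \<le> ((e / (exp 1 * p)) powr (1 / (p - 1))) powr (p - 1)"
      using p r by (intro powr_mono2) (auto simp: r_def)
    also have "\<dots> = e / (exp 1 * p)" using p e by (simp add: powr_powr)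
    finally show ?thesis .
  qed
  ultimately have "exp (r powr p) * (p * r powr (p - 1)) \<le> exp 1 * (p * (e / (exp 1 * p)))"
    using p by (intro mult_mono mult_left_mono) auto
  also have "\<dots> = e" using p by simp
  finally show thesis using that[OF r(1)] lipschitz_on_mono[OF exp_power_lipschitz[OF p r(1)]] by auto
qed

lemma exp_power_ge:
  assumes "p > 1" "x \<ge> 1"
  shows "x \<le> exp_power p x"
proof -
  from assms have "x \<le> x powr p" using powr_mono[of 1 p x] by simp
  then have "x \<le> exp (x powr p) - 1"
    using exp_ge_add_one_self[of "x powr p"] by linarith
  then show ?thesis using assms by (simp add: exp_power_def max_def)
qed

text \<open>
  From \<open>(x + h) powr p = (x + h) * (x + h) powr (p - 1) \<ge> x powr p + h * x powr (p - 1)\<close> the exponentials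
  differ by a factor \<open>exp (h * x powr (p - 1))\<close>, which is unbounded because \<open>p > 1\<close>.
\<close>
lemma exp_power_growth:
  assumes p: "p > 1" and h: "h > 0"
  shows "eventually (\<lambda>x. k * exp_power p x \<le> exp_power p (x + h)) at_top"
proof -
  let ?c = "max k 1 / h"
  have "eventually (\<lambda>x. ?c powr (1 / (p - 1)) \<le> x) at_top" by (rule eventually_ge_at_top)
  moreover have "eventually (\<lambda>x. x > (0::real)) at_top" by (rule eventually_gt_at_top)
  ultimately show ?thesis
  proof eventually_elim
    case (elim x)
    let ?E = "exp (x powr p)"
    have "?c = (?c powr (1 / (p - 1))) powr (p - 1)"
      using p h by (simp add: powr_powr)
    also have "\<dots> \<le> x powr (p - 1)" using elim p by (intro powr_mono2) auto
    finally have "max k 1 \<le> h * x powr (p - 1)"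
      using h by (simp only: pos_divide_le_eq mult.commute)
    then have large: "max k 1 \<le> exp (h * x powr (p - 1))"
      using exp_ge_add_one_self[of "h * x powr (p - 1)"] by linarith
    have "x powr p + h * x powr (p - 1) = (x + h) * x powr (p - 1)"
      using elim powr_add[of x 1 "p - 1"] by (simp add: algebra_simps)
    also have "\<dots> \<le> (x + h) * (x + h) powr (p - 1)"
      using elim h p by (intro mult_left_mono powr_mono2) auto
    also have "\<dots> = (x + h) powr p"
      using elim h powr_add[of "x + h" 1 "p - 1"] by simp
    finally have "?E * exp (h * x powr (p - 1)) \<le> exp ((x + h) powr p)"
      by (simp flip: exp_add)
    moreover have "?E * max k 1 \<le> ?E * exp (h * x powr (p - 1))"
      using large by (intro mult_left_mono) auto
    moreover have "k * (?E - 1) \<le> max k 1 * (?E - 1)"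
      by (intro mult_right_mono) auto
    moreover have "max k 1 * (?E - 1) \<le> ?E * max k 1 - 1"
      by (simp add: algebra_simps)
    ultimately have "k * (?E - 1) \<le> exp ((x + h) powr p) - 1" by linarith
    then show ?case using elim h by (simp add: exp_power_def max_def)
  qed
qed

section \<open>Existence\<close>

theorem theorem1p1:
  fixes T p :: real and a :: "real \<Rightarrow> real"
  assumes "T > 0" and "p > 1"
    and "continuous_on UNIV a"
    and "periodic_fun_simple a T"
    and "sign_changing a"
    and "finite {t \<in> {0..<T}. a t = 0}"
    and "integral {0..T} a < 0"
  shows "\<exists>u. periodic_solution T a (\<lambda>x. exp (x powr p) - 1) u \<and> (\<forall>t. u t > 0)"
proof -
  obtain c where c: "a c > 0" using assms(5) by (auto simp: sign_changing_def)
  \<comment> \<open>Start the clock at a time where \<open>a\<close> is positive.\<close>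
  define b where "b t = a (t + c)" for t
  have bper: "periodic_fun_simple b T"
    using assms(4) by (simp add: periodic_fun_simple_def b_def add.assoc add.commute[of T])
      (metis add.assoc add.commute)
  interpret indefinite_problem T b "exp_power p"
  proof
    show "T > 0" by fact
    show "continuous_on UNIV b"
      unfolding b_def by (intro continuous_on_compose2[OF assms(3)] continuous_intros) auto
    show "finite {t \<in> {0..T}. b t = 0}"
      unfolding b_def using assms by (intro finite_zeros_shift)
    show "b 0 > 0" using c by (simp add: b_def)
    show "integral {0..T} b < 0"
      unfolding b_def using integral_shift_periodic[OF assms(1,3,4)] assms(7) by simp
    show "exp_power p x = 0" if "x \<le> 0" for x using that \<open>p > 1\<close> by (simp add: exp_power_def max_def)
    show "exp_power p x > 0" if "x > 0" for x using that \<open>p > 1\<close> by (simp add: exp_power_def max_def)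
    show "mono (exp_power p)"
      by (rule monoI) (use \<open>p > 1\<close> in \<open>auto simp: exp_power_def intro!: powr_mono2\<close>)
    show "\<exists>L. L-lipschitz_on {..K} (exp_power p)" for K
      using lipschitz_on_subset[OF exp_power_lipschitz[of p "max K 1"]] \<open>p > 1\<close> by (meson atMost_subset_iff max.cobounded1 max.strict_coboundedI2 zero_less_one)
    show "\<exists>r>0. e-lipschitz_on {..r} (exp_power p)" if "e > 0" for e
      using exp_power_small[OF \<open>p > 1\<close> that] by blast
    show "eventually (\<lambda>x. k * exp_power p x \<le> exp_power p (x + h)) at_top" if "h > 0" for h k
      using exp_power_growth[OF \<open>p > 1\<close> that] .
    show "filterlim (exp_power p) at_top at_top"
      by (rule filterlim_at_top_mono[OF filterlim_ident])
        (use exp_power_ge[OF \<open>p > 1\<close>] in \<open>auto simp: eventually_at_top_linorder\<close>)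
  qed
  obtain U Y where UY: "\<And>t. (U has_real_derivative velocity (Y t)) (at t)"
    "\<And>t. (Y has_real_derivative - (b t * exp_power p (U t))) (at t)"
    "periodic_fun_simple U T" "periodic_fun_simple Y T" "\<And>t. U t > 0"
    using positive_periodic_orbit[OF bper] by blast
  define u where "u t = U (t - c)" for t
  have u: "(u has_real_derivative velocity (Y (t - c))) (at t)" for t
    using DERIV_shift[of U "velocity (Y (t - c))" t "- c"] UY(1)[of "t - c"] by (simp add: u_def[abs_def])
  have y: "((\<lambda>t. Y (t - c)) has_real_derivative - (a t * (exp (u t powr p) - 1))) (at t)" for t
    using DERIV_shift[of Y "- (a t * exp_power p (U (t - c)))" t "- c"] UY(2)[of "t - c"] UY(5)[of "t - c"]
    by (simp add: u_def b_def exp_power_def max_def)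
  have up: "u t > 0" for t using UY(5) by (simp add: u_def)
  have "continuous_on UNIV u" by (meson u DERIV_isCont continuous_at_imp_continuous_on)
  then have "continuous_on UNIV (\<lambda>t. exp (u t powr p) - 1)"
    using up by (intro continuous_intros) (auto simp: less_imp_neq[symmetric])
  moreover have "periodic_fun_simple u T"
  proof
    fix t
    interpret U: periodic_fun_simple U T by (fact UY(3))
    show "u (t + T) = u t" using U.plus_period[of "t - c"] by (simp add: u_def algebra_simps)
  qed
  ultimately have "periodic_solution T a (\<lambda>x. exp (x powr p) - 1) u"
    using assms(1,3,4) u y by (intro periodic_solutionI)
  then show ?thesis using up by blast
qed

end
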